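(* Let $e$ be an integer with $e>1$ and let $(s_0,s_1)\in\mathbb{N}^2$ be such that $s_0\le s_1$. Then, for every $n\ge 0$, the crystal bijection $\Psi_{(s_0,s_1)}^{(s_0,s_1+e)}:\Phi_{e,n}^{(s_0,s_1)}\to\Phi_{e,n}^{(s_0,s_1+e)}$ is given by the symbol map $\Upsilon_{(s_0,s_1)}:\Phi_{e,n}^{(s_0,s_1)}\to\Pi_{2,n}$, that is, $$\Psi_{(s_0,s_1)}^{(s_0,s_1+e)}=\Upsilon_{(s_0,s_1)}.$$
   Context: Here $\mathbb{N}=\{0,1,2,\dots\}$. **Bipartitions and nodes.** $\Pi_{2,n}$ is the set of bipartitions $\boldsymbol{\lambda}=(\lambda^{(0)},\lambda^{(1)})$ of rank $n$ (pairs of partitions of total size $n$). The diagram of $\boldsymbol{\lambda}$ is $[\boldsymbol{\lambda}]=\{(a,b,c) : c\in\{0,1\},\ a\ge1,\ 1\le b\le\lambda^{(c)}_a\}$. Let $e\ge 2$ and $\mathbf{s}=(s_0,s_1)\in\mathbb{Z}^2$. The residue of $\gamma=(a,b,c)$ is $b-a+s_c \bmod e$; if it equals $i$, $\gamma$ is called an $i$-node. If $[\boldsymbol{\mu}]=[\boldsymbol{\lambda}]\cup\{\gamma\}$ with $\gamma\notin[\boldsymbol{\lambda}]$, then $\gamma$ is an addable node of $\boldsymbol{\lambda}$ and a removable node of $\boldsymbol{\mu}$. **Order and good nodes.** For $i$-nodes $\gamma=(a,b,c)$, $\gamma'=(a',b',c')$ write $\gamma<_{(s_0,s_1)}\gamma'$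 if $b-a+s_c<b'-a'+s_{c'}$, or if $b-a+s_c=b'-a'+s_{c'}$ and $c'<c$. Given $\boldsymbol{\lambda}$ and $i\in\{0,\dots,e-1\}$, write all addable ($A$) and removable ($R$) $i$-nodes of $\boldsymbol{\lambda}$ in increasing order for $<_{(s_0,s_1)}$ and repeatedly delete adjacent pairs $RA$ until none remains. The remaining removable $i$-nodes are the normal $i$-nodes of $\boldsymbol{\lambda}$, and the smallest (leftmost) one, if any, is the good $i$-node of $\boldsymbol{\lambda}$. **Uglov bipartitions.** $\Phi_{e,0}^{\mathbf{s}}=\{(\emptyset,\emptyset)\}$ and, for $n\ge1$, $\boldsymbol{\lambda}\in\Pi_{2,n}$ lies in $\Phi_{e,n}^{\mathbf{s}}$ iff there are $i$ and a good $i$-node $\gamma$ of $\boldsymbol{\lambda}$ (for $e,\mathbf{s}$) such that removing $\gamma$ from $\boldsymbol{\lambda}$ gives an element of $\Phi_{e,n-1}^{\mathbf{s}}$. These are the vertices of the crystal graph of the irreducible $\mathcal{U}_v(\widehat{\mathfrak{sl}}_e)$-module of highest weight $\Lambda_{s_0 \bmod e}+\Lambda_{s_1\bmod e}$, with edges $\boldsymbol{\lambda}\xrightarrow{i}\boldsymbol{\mu}$ iff $[\boldsymbol{\mu}]\setminus[\boldsymbol{\lambda}]$ is a good $i$-node of $\boldsymbol{\mu}$. **The bijection $\Psi$.** If $\{s_0,s_1\}$ and $\{s_0',s_1'\}$ agree modulo $e$ (either $s_0'\equiv s_0,\ s_1'\equiv s_1$, or $s_0'\equiv s_1,\ s_1'\equiv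 s_0$), the corresponding crystal graphs are isomorphic, and $\Psi_{(s_0,s_1)}^{(s_0',s_1')}:\Phi_{e,n}^{(s_0,s_1)}\to\Phi_{e,n}^{(s_0',s_1')}$ ($n\ge0$) denotes the resulting bijection: it sends $(\emptyset,\emptyset)$ to $(\emptyset,\emptyset)$, and if $\boldsymbol{\lambda}\in\Phi_{e,n}^{(s_0,s_1)}$, $\gamma$ is a good $i$-node of $\boldsymbol{\lambda}$ for $<_{(s_0,s_1)}$ whose removal gives $\boldsymbol{\lambda}'\in\Phi_{e,n-1}^{(s_0,s_1)}$, and $\boldsymbol{\mu}'=\Psi_{(s_0,s_1)}^{(s_0',s_1')}(\boldsymbol{\lambda}')$, then $\Psi_{(s_0,s_1)}^{(s_0',s_1')}(\boldsymbol{\lambda})$ is the unique bipartition $\boldsymbol{\mu}$ obtained by adding to $\boldsymbol{\mu}'$ an $i$-node which is a good $i$-node of $\boldsymbol{\mu}$ for $<_{(s_0',s_1')}$. (It is a known fact that this is well defined, independent of choices.) **Symbols.** Let $\mathbf{s}=(s_0,s_1)\in\mathbb{N}^2$ with $s_0\le s_1$, let $\boldsymbol{\lambda}$ be a bipartition, $r_c$ the number of nonzero parts of $\lambda^{(c)}$, and fix $m\in\mathbb{N}$ with $m>\max(r_0-s_0,r_1-s_1)$. For $c\in\{0,1\}$ and $1\le i\le m+s_c$ put $\beta^{(c)}_i=\lambda^{(c)}_i-i+s_c+m$ (with $\lambda^{(c)}_i=0$ for $i>r_c$); then $\beta^{(c)}_1>\dots>\beta^{(c)}_{m+s_c}\ge0$.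 The $\mathbf{s}$-symbol $S_{\mathbf{s}}(\boldsymbol{\lambda})$ is the pair of rows (sets) $\beta^{(1)}$ (top) and $\beta^{(0)}$ (bottom); it determines $\boldsymbol{\lambda}$. **The map $\Upsilon$.** For $\boldsymbol{\lambda}\in\Phi_{e,n}^{\mathbf{s}}$ with symbol rows $\beta^{(1)},\beta^{(0)}$, define an injection $\theta:\beta^{(0)}\to\beta^{(1)}$ by processing the elements of $\beta^{(0)}$ from smallest to largest, i.e. in the order $\beta^{(0)}_{m+s_0},\beta^{(0)}_{m+s_0-1},\dots,\beta^{(0)}_1$: $\theta(\beta^{(0)}_p)$ is the largest element of $\beta^{(1)}\setminus\{\theta(\beta^{(0)}_{q}) : q>p\}$ that is $\le\beta^{(0)}_p$. (Such an element always exists when $\boldsymbol{\lambda}\in\Phi_{e,n}^{\mathbf{s}}$.) The pairs of the symbol are the $(j,\theta(j))$ with $j\in\beta^{(0)}$, $\theta(j)\ne j$. Let $S'$ be the symbol obtained by exchanging, for every pair $(j,\theta(j))$, the entry $j$ of $\beta^{(0)}$ with the entry $\theta(j)$ of $\beta^{(1)}$, and reordering the rows. Then $\Upsilon_{(s_0,s_1)}(\boldsymbol{\lambda})$ is the bipartition $\boldsymbol{\mu}\in\Pi_{2,n}$ with $S_{\mathbf{s}}(\boldsymbol{\mu})=S'$ (same $m$). This does not depend on $m$. *)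

theory Defs
  imports Main
begin

section \<open>Bipartitions and nodes\<close>

text \<open>A partition is the weakly decreasing list of its nonzero parts, so \<open>length\<close> is its number of
  nonzero parts and \<open>sum_list\<close> its size.\<close>

definition is_partition :: "nat list \<Rightarrow> bool" where
  "is_partition p \<longleftrightarrow> sorted_wrt (\<ge>) p \<and> 0 \<notin> set p"

definition part :: "nat list \<Rightarrow> nat \<Rightarrow> nat" where
  "part p a = (if 1 \<le> a \<and> a \<le> length p then p ! (a - 1) else 0)"

type_synonym bipartition = "nat list \<times> nat list"

text \<open>Pairs are indexed by 0 and 1; this is used for bipartitions as well as for charges.\<close>

definition pick :: "'a \<times> 'a \<Rightarrow> nat \<Rightarrow> 'a" where
  "pick x c = (if c = 0 then fst x else snd x)"

definition is_bipartition :: "bipartition \<Rightarrow> bool" where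
  "is_bipartition la \<longleftrightarrow> is_partition (fst la) \<and> is_partition (snd la)"

definition bip_rank :: "bipartition \<Rightarrow> nat" where
  "bip_rank la = sum_list (fst la) + sum_list (snd la)"

definition bipartitions :: "nat \<Rightarrow> bipartition set" where
  "bipartitions n = {la. is_bipartition la \<and> bip_rank la = n}"

type_synonym node = "nat \<times> nat \<times> nat"  \<comment> \<open>row, column, component\<close>

definition diagram :: "bipartition \<Rightarrow> node set" where
  "diagram la = {(a, b, c). c \<in> {0, 1} \<and> 1 \<le> a \<and> 1 \<le> b \<and> b \<le> part (pick la c) a}"

definition adds_node :: "bipartition \<Rightarrow> node \<Rightarrow> bipartition \<Rightarrow> bool" where
  "adds_node la g mu \<longleftrightarrow> is_bipartition la \<and> is_bipartition mu \<and>
     g \<notin> diagram la \<and> diagram mu = diagram la \<union> {g}"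

definition addable :: "bipartition \<Rightarrow> node \<Rightarrow> bool" where
  "addable la g \<longleftrightarrow> (\<exists>mu. adds_node la g mu)"

definition removable :: "bipartition \<Rightarrow> node \<Rightarrow> bool" where
  "removable la g \<longleftrightarrow> (\<exists>mu. adds_node mu g la)"

fun node_content :: "int \<times> int \<Rightarrow> node \<Rightarrow> int" where
  "node_content s (a, b, c) = int b - int a + pick s c"

definition node_residue :: "int \<Rightarrow> int \<times> int \<Rightarrow> node \<Rightarrow> int" where
  "node_residue e s g = node_content s g mod e"

fun node_component :: "node \<Rightarrow> nat" where
  "node_component (a, b, c) = c"

definition node_less :: "int \<times> int \<Rightarrow> node \<Rightarrow> node \<Rightarrow> bool" where
  "node_less s g g' \<longleftrightarrow> node_content s g < node_content s g' \<or>
     (node_content s g = node_content s g' \<and> node_component g' < node_component g)"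


section \<open>Good nodes\<close>

text \<open>The increasing list of all addable and removable \<open>i\<close>-nodes. Two such nodes with the same
  content and the same component coincide, so \<^const>\<open>node_less\<close> orders them strictly and totally
  and this list exists and is unique.\<close>

definition is_node_word :: "int \<Rightarrow> int \<times> int \<Rightarrow> bipartition \<Rightarrow> int \<Rightarrow> node list \<Rightarrow> bool" where
  "is_node_word e s la i w \<longleftrightarrow> sorted_wrt (node_less s) w \<and>
     set w = {g. (addable la g \<or> removable la g) \<and> node_residue e s g = i}"

inductive RA_deletion :: "bipartition \<Rightarrow> node list \<Rightarrow> node list \<Rightarrow> bool" for la where
  "removable la r \<Longrightarrow> addable la a \<Longrightarrow> RA_deletion la (u @ [r, a] @ v) (u @ v)"

definition normal_node :: "int \<Rightarrow> int \<times> int \<Rightarrow> bipartition \<Rightarrow> int \<Rightarrow> node \<Rightarrow> bool" where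
  "normal_node e s la i g \<longleftrightarrow> removable la g \<and>
     (\<exists>w v. is_node_word e s la i w \<and> (RA_deletion la)\<^sup>*\<^sup>* w v \<and>
        (\<nexists>v'. RA_deletion la v v') \<and> g \<in> set v)"

definition good_node :: "int \<Rightarrow> int \<times> int \<Rightarrow> bipartition \<Rightarrow> int \<Rightarrow> node \<Rightarrow> bool" where
  "good_node e s la i g \<longleftrightarrow> normal_node e s la i g \<and>
     (\<forall>g'. normal_node e s la i g' \<and> g' \<noteq> g \<longrightarrow> node_less s g g')"


section \<open>Uglov bipartitions and the crystal bijection\<close>

text \<open>No range for \<open>i\<close> has to be imposed: a good \<open>i\<close>-node has residue \<open>i\<close>, which lies in
  \<open>{0..<e}\<close> when \<open>e > 0\<close>.\<close>

definition crystal_edge :: "int \<Rightarrow> int \<times> int \<Rightarrow> int \<Rightarrow> bipartition \<Rightarrow> bipartition \<Rightarrow> bool" where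
  "crystal_edge e s i la mu \<longleftrightarrow> (\<exists>g. adds_node la g mu \<and> good_node e s mu i g)"

fun uglov_bipartitions :: "int \<Rightarrow> int \<times> int \<Rightarrow> nat \<Rightarrow> bipartition set" where
  "uglov_bipartitions e s 0 = {([], [])}"
| "uglov_bipartitions e s (Suc n) =
     {la \<in> bipartitions (Suc n). \<exists>i. \<exists>la' \<in> uglov_bipartitions e s n. crystal_edge e s i la' la}"

text \<open>The graph of the bijection from the crystal for the charge \<open>s\<close> to the one for \<open>s'\<close>: follow
  the same residues from the empty bipartition in both crystals.\<close>

inductive Psi_graph :: "int \<Rightarrow> int \<times> int \<Rightarrow> int \<times> int \<Rightarrow> bipartition \<Rightarrow> bipartition \<Rightarrow> bool"
  for e s s' where
  empty: "Psi_graph e s s' ([], []) ([], [])"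
| step: "Psi_graph e s s' la' mu' \<Longrightarrow> crystal_edge e s i la' la \<Longrightarrow> crystal_edge e s' i mu' mu
    \<Longrightarrow> Psi_graph e s s' la mu"

definition crystal_Psi :: "int \<Rightarrow> int \<times> int \<Rightarrow> int \<times> int \<Rightarrow> bipartition \<Rightarrow> bipartition" where
  "crystal_Psi e s s' la = (THE mu. Psi_graph e s s' la mu)"


section \<open>Symbols\<close>

definition symbol_admissible :: "nat \<times> nat \<Rightarrow> nat \<Rightarrow> bipartition \<Rightarrow> bool" where
  "symbol_admissible s m la \<longleftrightarrow>
     max (int (length (fst la)) - int (fst s)) (int (length (snd la)) - int (snd s)) < int m"

text \<open>The subtraction does not truncate, since \<open>i \<le> m + s\<^sub>c\<close>.\<close>

definition symbol_row :: "nat \<times> nat \<Rightarrow> nat \<Rightarrow> bipartition \<Rightarrow> nat \<Rightarrow> nat set" where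
  "symbol_row s m la c = (\<lambda>i. part (pick la c) i + (m + pick s c) - i) ` {1..m + pick s c}"

text \<open>Symbols are pairs (top row, bottom row); the top row belongs to component 1.\<close>

definition bip_symbol :: "nat \<times> nat \<Rightarrow> nat \<Rightarrow> bipartition \<Rightarrow> nat set \<times> nat set" where
  "bip_symbol s m la = (symbol_row s m la 1, symbol_row s m la 0)"

text \<open>\<open>theta_pairs T js\<close> lists all \<open>(j, \<theta>(j))\<close>, where \<open>js\<close> are the elements of the bottom
  row still to be processed, in this order, and \<open>T\<close> are the elements of the top row not yet
  used.\<close>

fun theta_pairs :: "nat set \<Rightarrow> nat list \<Rightarrow> (nat \<times> nat) list" where
  "theta_pairs T [] = []"
| "theta_pairs T (j # js) =
     (let t = Max {x \<in> T. x \<le> j} in (j, t) # theta_pairs (T - {t}) js)"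

definition symbol_pairs :: "nat set \<times> nat set \<Rightarrow> (nat \<times> nat) set" where
  "symbol_pairs S = {(j, t) \<in> set (theta_pairs (fst S) (sorted_list_of_set (snd S))). t \<noteq> j}"

definition exchange_pairs :: "nat set \<times> nat set \<Rightarrow> nat set \<times> nat set" where
  "exchange_pairs S =
     ((fst S - snd ` symbol_pairs S) \<union> fst ` symbol_pairs S,
      (snd S - fst ` symbol_pairs S) \<union> snd ` symbol_pairs S)"

definition symbol_Upsilon :: "nat \<times> nat \<Rightarrow> nat \<Rightarrow> bipartition \<Rightarrow> bipartition" where
  "symbol_Upsilon s m la = (THE mu. mu \<in> bipartitions (bip_rank la) \<and> symbol_admissible s m mu \<and>
     bip_symbol s m mu = exchange_pairs (bip_symbol s m la))"

end

theory Submission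
  imports Defs
begin

text \<open>
  A node of component \<open>c\<close> and content \<open>k\<close> is seen in the symbol at the coordinate \<open>x = k + m\<close>: it is
  addable iff the row \<open>\<beta>\<^sup>(\<^sup>c\<^sup>)\<close> contains \<open>x - 1\<close> but not \<open>x\<close>, removable iff it contains \<open>x\<close> but not
  \<open>x - 1\<close>, and adding it moves the entry \<open>x - 1\<close> to \<open>x\<close>. For the charge \<open>(s\<^sub>0, s\<^sub>1)\<close> the letter of the
  top row \<open>T\<close> at \<open>x\<close> precedes the letter of the bottom row \<open>B\<close> at \<open>x\<close>. Raising \<open>s\<^sub>1\<close> by \<open>e\<close> shifts the
  letters of the top row by \<open>e\<close>; as letters of one residue have coordinates congruent modulo \<open>e\<close>, the
  only effect is that at each \<open>x\<close> the bottom row now comes first. So the theorem compares two ways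
  of reading a pair of rows, and \<open>\<Upsilon>\<close> is the combinatorial R-matrix that exchanges the two factors
  \<open>T\<close> and \<open>B\<close> of a tensor product of crystals of columns.

  With the elements of \<open>T\<close> as opening and those of \<open>B\<close> as closing brackets, the image of \<open>\<theta>\<close> is the
  set \<open>matched T B\<close> of the opening brackets that are closed, and \<open>\<Upsilon>\<close> replaces \<open>(T, B)\<close> by
  \<open>((T - matched T B) \<union> B, matched T B)\<close> (\<open>exchange_pairs_eq\<close>). This description is well suited to
  moving one entry from \<open>x - 1\<close> to \<open>x\<close>, because such a move changes the bracket count at one place
  only. Two local facts result: at every \<open>x\<close> the two-letter words before and after the exchange,
  read in the respective orders, have the same reduced form (\<open>letter_exchange\<close>), and the
  exchange commutes with the move that turns the rightmost uncancelled \<open>A\<close> of the word at \<open>x\<close> into \<open>R\<close>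
  (\<open>exchange_slide\<close>).

  They determine the crystal operators for all \<open>e\<close>. Counting \<open>R\<close> as 1 and \<open>A\<close> as \<open>-1\<close>, the good node
  to be added is where the partial sums of the word first reach their minimum (\<open>good_node_iff\<close>,
  \<open>crystal_edge_iff\<close>). Equal reduced words at every \<open>x\<close> give equal partial sums between the
  coordinates and equal minima within them, so both charges choose the same \<open>x\<close>
  (\<open>first_minimum_swap\<close>), where the local statement applies. Thus \<open>\<Upsilon>\<close> carries edges to edges
  (\<open>exchange_related_step\<close>). As it fixes the empty bipartition and the operators are single-valued
  (\<open>crystal_edge_unique\<close>), it coincides with \<open>\<Psi>\<close>.
\<close>

section \<open>Cancellation in signed words\<close>

text \<open>A word of nodes is encoded by signs: \<open>f\<close> is 1 on removable nodes and \<open>-1\<close> on addable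
  ones, so that \<open>R\<close> acts as an opening and \<open>A\<close> as a closing bracket. An \<open>R\<close> survives the
  deletion of the pairs \<open>RA\<close> iff no partial sum of the letters to its right is negative; the
  least of these sums, that of the empty prefix included, is \<open>lowest\<close>.\<close>

fun lowest :: "('a \<Rightarrow> int) \<Rightarrow> 'a list \<Rightarrow> int" where
  "lowest f [] = 0"
| "lowest f (g # w) = min 0 (f g + lowest f w)"

fun survivors :: "('a \<Rightarrow> int) \<Rightarrow> 'a list \<Rightarrow> 'a set" where
  "survivors f [] = {}"
| "survivors f (g # w) = (if f g = 1 \<and> lowest f w = 0 then {g} else {}) \<union> survivors f w"

lemma lowest_nonpos: "lowest f w \<le> 0"
  by (cases w) auto

text \<open>A deleted pair contributes \<open>+1\<close> and then \<open>-1\<close>, which creates no new least partial sum.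
  Hence neither \<open>lowest\<close> nor the set of survivors depends on the order of the deletions.\<close>

lemma lowest_delete:
  assumes "f r = 1" "f a = - 1"
  shows "lowest f (u @ [r, a] @ v) = lowest f (u @ v)"
  using assms lowest_nonpos[of f v] by (induction u) auto

lemma survivors_delete:
  assumes "f r = 1" "f a = - 1"
  shows "survivors f (u @ [r, a] @ v) = survivors f (u @ v)"
proof (induction u)
  case Nil
  then show ?case using assms lowest_nonpos[of f v] by auto
next
  case (Cons b u)
  then show ?case using lowest_delete[of f, OF assms, of u v] by auto
qed

text \<open>In an irreducible word the letter after an \<open>R\<close> is again an \<open>R\<close>, so such a word consists
  of addable nodes followed by removable ones and every \<open>R\<close> survives. The second conjunct
  strengthens the claim for the induction.\<close>

lemma survivors_irreducible:
  assumes "\<And>g. g \<in> set w \<Longrightarrow> f g = 1 \<or> f g = - 1"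
    and "\<nexists>u r a v. w = u @ [r, a] @ v \<and> f r = 1 \<and> f a = - 1"
  shows "survivors f w = {g \<in> set w. f g = 1}
    \<and> (w \<noteq> [] \<and> f (hd w) = 1 \<longrightarrow> lowest f w = 0 \<and> (\<forall>g\<in>set w. f g = 1))"
  using assms
proof (induction w)
  case Nil
  then show ?case by simp
next
  case (Cons g w)
  have irr: "\<nexists>u r a v. w = u @ [r, a] @ v \<and> f r = 1 \<and> f a = - 1"
  proof
    assume "\<exists>u r a v. w = u @ [r, a] @ v \<and> f r = 1 \<and> f a = - 1"
    then obtain u r a v where "g # w = (g # u) @ [r, a] @ v" "f r = 1" "f a = - 1" by auto
    with Cons.prems(2) show False by blast
  qed
  have IH: "survivors f w = {g \<in> set w. f g = 1}
    \<and> (w \<noteq> [] \<and> f (hd w) = 1 \<longrightarrow> lowest f w = 0 \<and> (\<forall>g\<in>set w. f g = 1))"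
    using Cons.IH[OF _ irr] Cons.prems(1) by auto
  have hd: "f (hd w) = 1" if "w \<noteq> []" "f g = 1"
  proof (rule ccontr)
    assume "f (hd w) \<noteq> 1"
    then have "f (hd w) = - 1" using Cons.prems(1)[of "hd w"] that by auto
    moreover have "g # w = [] @ [g, hd w] @ tl w" using that by simp
    ultimately show False using Cons.prems(2) that by blast
  qed
  show ?case
  proof (cases "f g = 1")
    case True
    then have "lowest f w = 0 \<and> (\<forall>g\<in>set w. f g = 1)"
      using hd IH by (cases "w = []") (simp, blast)
    moreover from this True have "survivors f (g # w) = insert g (survivors f w)" by simp
    ultimately show ?thesis using True conjunct1[OF IH] by simp blast
  next
    case False
    then show ?thesis using conjunct1[OF IH] by auto
  qed
qed

lemma sum_greaterThanAtMost_split: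
  fixes E :: "nat \<Rightarrow> int"
  assumes "l < a" "a \<le> q" "\<And>p. l < p \<Longrightarrow> p < a \<Longrightarrow> E p = 0"
  shows "sum E {l<..q} = E a + sum E {a<..q}"
proof -
  have "{l<..q} = {l<..<a} \<union> insert a {a<..q}" using assms by auto
  then have "sum E {l<..q} = sum E {l<..<a} + sum E (insert a {a<..q})"
    by (simp only:) (rule sum.union_disjoint, auto)
  then show ?thesis using assms(3) by simp
qed

text \<open>From words to functions on positions: once the nodes are placed at increasing positions, and
  the signs are transported to a function \<open>E\<close> that vanishes elsewhere, partial sums of the word
  become sums of \<open>E\<close> over intervals. This removes the word itself from all later arguments.\<close>

lemma lowest_ge_iff:
  fixes E :: "nat \<Rightarrow> int" and pos :: "'a \<Rightarrow> nat"
  assumes "sorted_wrt (\<lambda>g g'. pos g < pos g') w"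
    and "\<And>g. g \<in> set w \<Longrightarrow> l < pos g \<and> E (pos g) = f g"
    and "\<And>p. l < p \<Longrightarrow> E p \<noteq> 0 \<Longrightarrow> p \<in> pos ` set w"
  shows "k \<le> lowest f w \<longleftrightarrow> (\<forall>q. k \<le> sum E {l<..q})"
  using assms
proof (induction w arbitrary: l k)
  case Nil
  then have "sum E {l<..q} = 0" for q by (intro sum.neutral) force
  then show ?case by simp
next
  case (Cons a w)
  have IH: "k \<le> lowest f w \<longleftrightarrow> (\<forall>q. k \<le> sum E {pos a<..q})" for k
  proof (rule Cons.IH)
    show "sorted_wrt (\<lambda>g g'. pos g < pos g') w" using Cons.prems(1) by simp
    show "pos a < pos g \<and> E (pos g) = f g" if "g \<in> set w" for g
      using Cons.prems(1,2) that by simp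
    show "p \<in> pos ` set w" if "pos a < p" "E p \<noteq> 0" for p
      using Cons.prems(2)[of a] Cons.prems(3)[of p] that by auto
  qed
  have la: "l < pos a" and fa: "E (pos a) = f a" using Cons.prems(2) by auto
  have gap: "E p = 0" if "l < p" "p < pos a" for p
    using Cons.prems(1) Cons.prems(3)[of p] that by force
  have below: "sum E {l<..q} = 0" if "q < pos a" for q
    using gap that by (intro sum.neutral) auto
  have above: "sum E {l<..q} = f a + sum E {pos a<..q}" if "pos a \<le> q" for q
    using sum_greaterThanAtMost_split[OF la that, of E] gap fa by simp
  have "k \<le> lowest f (a # w) \<longleftrightarrow> k \<le> 0 \<and> (\<forall>q. k - f a \<le> sum E {pos a<..q})"
    using IH[of "k - f a"] by auto
  also have "\<dots> \<longleftrightarrow> (\<forall>q. k \<le> sum E {l<..q})"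
  proof safe
    fix q assume "k \<le> 0" "\<forall>q. k - f a \<le> sum E {pos a<..q}"
    then show "k \<le> sum E {l<..q}"
      using below[of q] above[of q] by (cases "q < pos a") (auto simp: not_less algebra_simps dest: spec[of _ q])
  next
    assume *: "\<forall>q. k \<le> sum E {l<..q}"
    from *[rule_format, of l] show "k \<le> 0" by simp
    fix q
    show "k - f a \<le> sum E {pos a<..q}"
      using *[rule_format, of "max q (pos a)"] above[of "max q (pos a)"] by (cases "q \<le> pos a") (auto simp: max_def)
  qed
  finally show ?case .
qed

lemma survivors_iff:
  fixes E :: "nat \<Rightarrow> int" and pos :: "'a \<Rightarrow> nat"
  assumes "sorted_wrt (\<lambda>g g'. pos g < pos g') w"
    and "\<And>g. g \<in> set w \<Longrightarrow> E (pos g) = f g"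
    and "\<And>p g. g \<in> set w \<Longrightarrow> pos g < p \<Longrightarrow> E p \<noteq> 0 \<Longrightarrow> p \<in> pos ` set w"
  shows "g \<in> survivors f w \<longleftrightarrow> g \<in> set w \<and> f g = 1 \<and> (\<forall>q. 0 \<le> sum E {pos g<..q})"
  using assms
proof (induction w)
  case Nil
  then show ?case by simp
next
  case (Cons a w)
  have "p \<in> pos ` set w" if "h \<in> set w" "pos h < p" "E p \<noteq> 0" for p h
  proof -
    have "pos a < pos h" using Cons.prems(1) that by simp
    then show ?thesis using Cons.prems(3)[of h p] that by auto
  qed
  then have IH: "g \<in> survivors f w \<longleftrightarrow> g \<in> set w \<and> f g = 1 \<and> (\<forall>q. 0 \<le> sum E {pos g<..q})"
    using Cons.IH Cons.prems(1,2) by auto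
  have "0 \<le> lowest f w \<longleftrightarrow> (\<forall>q. 0 \<le> sum E {pos a<..q})"
  proof (rule lowest_ge_iff)
    show "sorted_wrt (\<lambda>g g'. pos g < pos g') w" using Cons.prems(1) by simp
    show "pos a < pos g \<and> E (pos g) = f g" if "g \<in> set w" for g
      using Cons.prems(1,2) that by simp
    show "p \<in> pos ` set w" if "pos a < p" "E p \<noteq> 0" for p
      using Cons.prems(3)[of a p] that by auto
  qed
  then have low: "lowest f w = 0 \<longleftrightarrow> (\<forall>q. 0 \<le> sum E {pos a<..q})"
    using lowest_nonpos[of f w] by (metis order_antisym order_refl)
  have "a \<notin> set w" using Cons.prems(1) by auto
  then show ?case using IH low by auto
qed

section \<open>Good nodes as first minima\<close>

definition node_sign :: "bipartition \<Rightarrow> node \<Rightarrow> int" where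
  "node_sign la g = (if removable la g then 1 else if addable la g then - 1 else 0)"

definition signature_nodes :: "int \<Rightarrow> int \<times> int \<Rightarrow> bipartition \<Rightarrow> int \<Rightarrow> node set" where
  "signature_nodes e s la i = {g. (addable la g \<or> removable la g) \<and> node_residue e s g = i}"

lemma not_addable_removable: "addable la g \<Longrightarrow> \<not> removable la g"
  unfolding addable_def removable_def adds_node_def by auto

text \<open>The placement of the addable and removable \<open>i\<close>-nodes at positions is compatible with the
  order of nodes, and \<open>E\<close> is the resulting sign function.\<close>

definition encodes_signature ::
  "int \<Rightarrow> int \<times> int \<Rightarrow> bipartition \<Rightarrow> int \<Rightarrow> (node \<Rightarrow> nat) \<Rightarrow> (nat \<Rightarrow> int) \<Rightarrow> bool" where
  "encodes_signature e s la i pos E \<longleftrightarrow>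
     inj_on pos (signature_nodes e s la i) \<and>
     (\<forall>g\<in>signature_nodes e s la i. \<forall>g'\<in>signature_nodes e s la i.
        node_less s g g' \<longleftrightarrow> pos g < pos g') \<and>
     (\<forall>g\<in>signature_nodes e s la i. E (pos g) = node_sign la g) \<and>
     {p. E p \<noteq> 0} \<subseteq> pos ` signature_nodes e s la i \<and>
     finite {p. E p \<noteq> 0}"

lemma RA_deletion_survivors:
  assumes "(RA_deletion la)\<^sup>*\<^sup>* w v"
  shows "survivors (node_sign la) w = survivors (node_sign la) v \<and> set v \<subseteq> set w"
  using assms
proof induction
  case base
  then show ?case by simp
next
  case (step v v')
  from step.hyps(2) show ?case
  proof cases
    case (1 r a x y)
    then have "node_sign la r = 1" "node_sign la a = - 1"
      using not_addable_removable by (auto simp: node_sign_def)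
    from survivors_delete[of "node_sign la", OF this, of x y] step.IH 1 show ?thesis by auto
  qed
qed

lemma RA_deletion_normal_form: "\<exists>v. (RA_deletion la)\<^sup>*\<^sup>* w v \<and> (\<nexists>v'. RA_deletion la v v')"
proof (induction "length w" arbitrary: w rule: less_induct)
  case less
  show ?case
  proof (cases "\<exists>v'. RA_deletion la w v'")
    case True
    then obtain v' where v': "RA_deletion la w v'" by blast
    then have "length v' < length w" by cases auto
    with less v' show ?thesis by (meson converse_rtranclp_into_rtranclp)
  qed auto
qed

text \<open>The word of nodes exists because the positions can be sorted, and by the invariance of the
  survivors every complete deletion leaves the same removable nodes.\<close>

lemma normal_node_iff:
  assumes enc: "encodes_signature e s la i pos E"
  shows "normal_node e s la i g \<longleftrightarrow>
    removable la g \<and> node_residue e s g = i \<and> (\<forall>q. 0 \<le> sum E {pos g<..q})"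
proof -
  define W where "W = signature_nodes e s la i"
  have inj: "inj_on pos W" and less: "\<And>g g'. g \<in> W \<Longrightarrow> g' \<in> W \<Longrightarrow> node_less s g g' \<longleftrightarrow> pos g < pos g'"
    and EW: "\<And>g. g \<in> W \<Longrightarrow> E (pos g) = node_sign la g" and supp: "{p. E p \<noteq> 0} \<subseteq> pos ` W"
    and fin: "finite {p. E p \<noteq> 0}"
    using enc unfolding encodes_signature_def W_def by auto
  have sign: "node_sign la h = 1 \<or> node_sign la h = - 1" if "h \<in> W" for h
    using that by (auto simp: W_def signature_nodes_def node_sign_def)
  have "pos ` W \<subseteq> {p. E p \<noteq> 0}"
  proof
    fix p assume "p \<in> pos ` W"
    then obtain h where "h \<in> W" "p = pos h" by blast
    then show "p \<in> {p. E p \<noteq> 0}" using EW[of h] sign[of h] by auto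
  qed
  then have "finite W" using fin inj by (meson finite_imageD finite_subset)
  have word_iff: "is_node_word e s la i w \<longleftrightarrow>
      sorted_wrt (\<lambda>g g'. pos g < pos g') w \<and> set w = W" for w
  proof -
    have "sorted_wrt (node_less s) w \<longleftrightarrow> sorted_wrt (\<lambda>g g'. pos g < pos g') w" if "set w = W"
      using that less by (auto intro: sorted_wrt_mono_rel[rotated])
    then show ?thesis unfolding is_node_word_def W_def signature_nodes_def by blast
  qed
  have surv: "h \<in> survivors (node_sign la) w \<longleftrightarrow>
      removable la h \<and> node_residue e s h = i \<and> (\<forall>q. 0 \<le> sum E {pos h<..q})"
    if "is_node_word e s la i w" for h w
  proof -
    have w: "sorted_wrt (\<lambda>g g'. pos g < pos g') w" "set w = W" using that word_iff by auto
    have "h \<in> survivors (node_sign la) w \<longleftrightarrow>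
      h \<in> set w \<and> node_sign la h = 1 \<and> (\<forall>q. 0 \<le> sum E {pos h<..q})"
      by (rule survivors_iff) (use w EW supp in auto)
    then show ?thesis using w(2)
      by (auto simp: W_def signature_nodes_def node_sign_def split: if_splits)
  qed
  have irr: "survivors (node_sign la) v = {h \<in> set v. removable la h}"
    if "set v \<subseteq> W" "\<nexists>v'. RA_deletion la v v'" for v
  proof -
    have "\<nexists>u r a y. v = u @ [r, a] @ y \<and> node_sign la r = 1 \<and> node_sign la a = - 1"
    proof (rule notI, elim exE conjE)
      fix u r a y
      assume "v = u @ [r, a] @ y" "node_sign la r = 1" "node_sign la a = - 1"
      then have "RA_deletion la v (u @ y)"
        by (auto simp: node_sign_def split: if_splits intro: RA_deletion.intros[of la r a u y, simplified])
      with that(2) show False by blast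
    qed
    then have "survivors (node_sign la) v = {h \<in> set v. node_sign la h = 1}"
      using survivors_irreducible[of v "node_sign la"] sign that(1) by blast
    then show ?thesis by (auto simp: node_sign_def split: if_splits)
  qed
  show ?thesis
  proof
    assume "normal_node e s la i g"
    then obtain w v where w: "is_node_word e s la i w" and v: "(RA_deletion la)\<^sup>*\<^sup>* w v"
      "\<nexists>v'. RA_deletion la v v'" "g \<in> set v" "removable la g"
      unfolding normal_node_def by blast
    from RA_deletion_survivors[OF v(1)] have "set v \<subseteq> W" 
      "survivors (node_sign la) w = survivors (node_sign la) v" using w word_iff by auto
    with irr[of v] v have "g \<in> survivors (node_sign la) w" by auto
    then show "removable la g \<and> node_residue e s g = i \<and> (\<forall>q. 0 \<le> sum E {pos g<..q})"
      using surv[OF w] by simp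
  next
    assume g: "removable la g \<and> node_residue e s g = i \<and> (\<forall>q. 0 \<le> sum E {pos g<..q})"
    define w where "w = map (inv_into W pos) (sorted_list_of_set (pos ` W))"
    have inv: "pos (inv_into W pos p) = p" if "p \<in> pos ` W" for p
      using that by (rule f_inv_into_f)
    have "set w = W"
      using \<open>finite W\<close> inj by (auto simp: w_def)
    moreover have "sorted_wrt (\<lambda>g g'. pos g < pos g') w"
    proof -
      have "map pos w = sorted_list_of_set (pos ` W)"
        using \<open>finite W\<close> inv by (auto simp: w_def o_def intro: map_idI)
      then have "sorted_wrt (<) (map pos w)" by simp
      then show ?thesis by (simp add: sorted_wrt_map)
    qed
    ultimately have w: "is_node_word e s la i w" using word_iff by simp
    obtain v where v: "(RA_deletion la)\<^sup>*\<^sup>* w v" "\<nexists>v'. RA_deletion la v v'"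
      using RA_deletion_normal_form by blast
    from RA_deletion_survivors[OF v(1)] have "set v \<subseteq> W" 
      "survivors (node_sign la) w = survivors (node_sign la) v" using w word_iff by auto
    with irr[of v] v surv[OF w, of g] g have "g \<in> set v" by auto
    then show "normal_node e s la i g" unfolding normal_node_def using g w v by blast
  qed
qed

lemma sum_lessThan_diff:
  fixes E :: "nat \<Rightarrow> int"
  shows "a \<le> b \<Longrightarrow> sum E {a..<b} = sum E {..<b} - sum E {..<a}"
  using sum.atLeastLessThan_concat[of 0 a b E] unfolding atLeast0LessThan by linarith

lemma sum_greaterThanAtMost_nat:
  fixes E :: "nat \<Rightarrow> int"
  shows "P \<le> q \<Longrightarrow> sum E {P<..q} = sum E {..<Suc q} - sum E {..<Suc P}"
  using sum_lessThan_diff[of "Suc P" "Suc q" E]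
  by (simp only: atLeastLessThanSuc_atLeastAtMost atLeastSucAtMost_greaterThanAtMost Suc_le_mono)

text \<open>If \<open>P\<close> carries the sign \<open>-1\<close>, this says that the partial sums of \<open>E\<close> attain their minimum
  for the first time when the letter at \<open>P\<close> has been read.\<close>

definition first_minimum :: "(nat \<Rightarrow> int) \<Rightarrow> nat \<Rightarrow> bool" where
  "first_minimum E P \<longleftrightarrow> (\<forall>q\<le>P. sum E {..<P} \<le> sum E {..<q}) \<and>
     (\<forall>q>P. sum E {..<P} - 1 \<le> sum E {..<q})"

text \<open>Resetting the sign at a good node to \<open>-1\<close> gives the signs before the node was added; there it
  is the rightmost surviving addable node, which is the place where the partial sums first reach
  their minimum. Conversely, if an earlier partial sum were below the one at \<open>g\<close>, then the last
  such place would be a normal node smaller than \<open>g\<close>.\<close>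

lemma good_node_iff:
  assumes enc: "encodes_signature e s la i pos E"
  shows "good_node e s la i g \<longleftrightarrow>
    removable la g \<and> node_residue e s g = i \<and> first_minimum (E(pos g := - 1)) (pos g)"
proof -
  define W where "W = signature_nodes e s la i"
  define S where "S q = sum E {..<q}" for q
  have S_Suc: "S (Suc q) = S q + E q" for q by (simp add: S_def)
  have inj: "inj_on pos W" and less: "\<And>g g'. g \<in> W \<Longrightarrow> g' \<in> W \<Longrightarrow> node_less s g g' \<longleftrightarrow> pos g < pos g'"
    and EW: "\<And>g. g \<in> W \<Longrightarrow> E (pos g) = node_sign la g" and supp: "{p. E p \<noteq> 0} \<subseteq> pos ` W"
    using enc unfolding encodes_signature_def W_def by auto
  have rem: "removable la h \<and> node_residue e s h = i \<longleftrightarrow> h \<in> W \<and> E (pos h) = 1" for h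
    using EW[of h] by (auto simp: W_def signature_nodes_def node_sign_def split: if_splits)
  have nn: "normal_node e s la i h \<longleftrightarrow> h \<in> W \<and> E (pos h) = 1 \<and> (\<forall>q>pos h. S q \<ge> S (pos h) + 1)" for h
  proof -
    have "(\<forall>q. 0 \<le> sum E {pos h<..q}) \<longleftrightarrow> (\<forall>q\<ge>pos h. S (Suc q) \<ge> S (Suc (pos h)))"
      using sum_greaterThanAtMost_nat[of "pos h" _ E] unfolding S_def
      by (smt (verit, best) greaterThanAtMost_empty nle_le sum.empty)
    also have "\<dots> \<longleftrightarrow> (\<forall>q>pos h. S q \<ge> S (Suc (pos h)))"
      by (metis Suc_le_D Suc_le_eq Suc_le_mono)
    finally show ?thesis using normal_node_iff[OF enc, of h] rem[of h] S_Suc[of "pos h"] by auto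
  qed
  have sums: "sum (E(pos g := - 1)) {..<q} = (if q \<le> pos g then S q else S q - E (pos g) - 1)" for q
  proof (induction q)
    case (Suc q)
    then show ?case by (auto simp: S_Suc not_le le_Suc_eq)
  qed (simp add: S_def)
  have fm: "first_minimum (E(pos g := - 1)) (pos g) \<longleftrightarrow>
      (\<forall>q\<le>pos g. S (pos g) \<le> S q) \<and> (\<forall>q>pos g. S q \<ge> S (pos g) + E (pos g))"
    unfolding first_minimum_def sums by (auto simp: algebra_simps)
  have bd: "E p \<le> 1" for p
  proof (cases "E p = 0")
    case False
    then obtain h where "h \<in> W" "p = pos h" using supp by auto
    then show ?thesis using EW by (auto simp: node_sign_def)
  qed simp
  show ?thesis
  proof
    assume good: "good_node e s la i g"
    then have g: "g \<in> W" "E (pos g) = 1" "\<And>q. q > pos g \<Longrightarrow> S q \<ge> S (pos g) + 1"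
      using nn[of g] unfolding good_node_def by auto
    have "S (pos g) \<le> S q" if "q \<le> pos g" for q
    proof (rule ccontr)
      assume "\<not> S (pos g) \<le> S q"
      \<comment> \<open>The last place where a partial sum is smaller is followed by a normal node.\<close>
      define Q where "Q = {q. q \<le> pos g \<and> S q < S (pos g)}"
      have "q \<in> Q" "finite Q" using that \<open>\<not> S (pos g) \<le> S q\<close> by (auto simp: Q_def)
      define p where "p = Max Q"
      have "p \<in> Q" unfolding p_def using \<open>q \<in> Q\<close> \<open>finite Q\<close> by (intro Max_in) auto
      then have p: "p < pos g" "S p < S (pos g)" by (auto simp: Q_def le_less)
      have mx: "S r \<ge> S (pos g)" if "p < r" "r \<le> pos g" for r
        using Max_ge[OF \<open>finite Q\<close>, of r] that by (fastforce simp: Q_def p_def)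
      have Ep: "E p = 1" "S (Suc p) = S (pos g)"
        using mx[of "Suc p"] p bd[of p] S_Suc[of p] by auto
      obtain h where h: "h \<in> W" "p = pos h" using supp Ep by force
      have "S r \<ge> S p + 1" if "p < r" for r
        using mx[of r] that g(3)[of r] p Ep S_Suc[of p] by (cases "r \<le> pos g") auto
      then have "normal_node e s la i h" using nn h Ep by auto
      moreover have "h \<noteq> g" using p h by auto
      ultimately have "node_less s g h" using good unfolding good_node_def by blast
      then show False using less[OF g(1) h(1)] p h by auto
    qed
    then show "removable la g \<and> node_residue e s g = i \<and> first_minimum (E(pos g := - 1)) (pos g)"
      using rem[of g] g fm by auto
  next
    assume "removable la g \<and> node_residue e s g = i \<and> first_minimum (E(pos g := - 1)) (pos g)"
    then have g: "g \<in> W" "E (pos g) = 1" "\<And>q. q \<le> pos g \<Longrightarrow> S (pos g) \<le> S q"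
      "\<And>q. q > pos g \<Longrightarrow> S q \<ge> S (pos g) + 1" using rem[of g] fm by auto
    have "node_less s g h" if "normal_node e s la i h" "h \<noteq> g" for h
    proof (rule ccontr)
      assume "\<not> node_less s g h"
      with less[of g h] g(1) that nn[of h] have "pos h \<le> pos g" by auto
      then have "pos h < pos g" using inj g(1) that nn[of h] by (auto simp: inj_on_def le_less)
      then show False using g(3)[of "pos h"] that(1) nn[of h] by force
    qed
    then show "good_node e s la i g" unfolding good_node_def using nn[of g] g by auto
  qed
qed

text \<open>This is why a crystal operator has at most one value.\<close>

lemma first_minimum_unique:
  assumes "first_minimum E P" "E P = - 1" "first_minimum E Q" "E Q = - 1"
  shows "P = Q"
proof -
  have "False" if "P < Q" "first_minimum E P" "E P = - 1" "first_minimum E Q" "E Q = - 1" for P Q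
  proof -
    have "sum E {..<P} - 1 \<le> sum E {..<Suc Q}" "sum E {..<Q} \<le> sum E {..<Suc P}"
      using that Suc_leI[OF that(1)] less_SucI[OF that(1)] unfolding first_minimum_def by blast+
    then show False using that by simp
  qed
  then show ?thesis using assms by (meson linorder_neqE_nat)
qed

section \<open>The exchange map on rows\<close>

text \<open>The height before \<open>v\<close> of the path that climbs at the elements of \<open>T\<close> and descends at those of
  \<open>B\<close>.\<close>

primrec excess :: "nat set \<Rightarrow> nat set \<Rightarrow> nat \<Rightarrow> int" where
  "excess T B 0 = 0"
| "excess T B (Suc v) = excess T B v + of_bool (v \<in> T) - of_bool (v \<in> B)"

text \<open>Under this condition every element of the bottom row finds a partner in the top row.\<close>

definition ballot :: "nat set \<Rightarrow> nat set \<Rightarrow> bool" where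
  "ballot T B \<longleftrightarrow> (\<forall>v. 0 \<le> excess T B v)"

text \<open>The image of \<open>\<theta>\<close>, described without reference to an order of processing: reading the rows from
  left to right, with the elements of \<open>T\<close> as opening and those of \<open>B\<close> as closing brackets, the
  bracket opened at \<open>t\<close> is closed iff the excess returns to its value before \<open>t\<close>.\<close>

definition matched :: "nat set \<Rightarrow> nat set \<Rightarrow> nat set" where
  "matched T B = {t \<in> T. \<exists>w>t. excess T B w \<le> excess T B t}"

lemma excess_remove_pair:
  assumes "t \<in> T" "j \<in> B"
  shows "excess (T - {t}) (B - {j}) v = excess T B v - of_bool (t < v) + of_bool (j < v)"
  using assms by (induction v) (auto simp: less_Suc_eq)

text \<open>Below the smallest element of \<open>B\<close> the excess only grows, and it grows strictly past every
  element of \<open>T\<close>.\<close>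

lemma excess_mono_free:
  assumes "\<And>b. b \<in> B \<Longrightarrow> v \<le> b" "u \<le> v"
  shows "excess T B u \<le> excess T B v"
  using assms(2,1)
proof (induction v rule: dec_induct)
  case (step n)
  then have "n \<notin> B" by fastforce
  moreover have "excess T B u \<le> excess T B n" using step by (meson Suc_leD)
  ultimately show ?case by simp
qed simp

lemma excess_less_free:
  assumes "\<And>b. b \<in> B \<Longrightarrow> v \<le> b" "u < v" "u \<in> T"
  shows "excess T B u < excess T B v"
proof -
  have "u \<notin> B" using assms by fastforce
  then have "excess T B u < excess T B (Suc u)" using assms(3) by simp
  also have "\<dots> \<le> excess T B v" using assms by (intro excess_mono_free) auto
  finally show ?thesis .
qed

text \<open>One step of the construction of \<open>\<theta>\<close>: the smallest \<open>j\<close> of the bottom row closes the last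
  bracket \<open>t\<close> opened up to \<open>j\<close>. Removing both changes the excess only between them, in
  a region without elements of the bottom row, so no other element changes its status.\<close>

lemma theta_step:
  assumes "ballot T B" "j \<in> B" "\<And>b. b \<in> B \<Longrightarrow> j \<le> b" "t = Max {x \<in> T. x \<le> j}"
  shows "t \<in> T" "t \<le> j" "ballot (T - {t}) (B - {j})"
    "matched T B = insert t (matched (T - {t}) (B - {j}))"
proof -
  let ?d = "excess T B" and ?d1 = "excess (T - {t}) (B - {j})"
  have "{x \<in> T. x \<le> j} \<noteq> {}"
  proof
    assume "{x \<in> T. x \<le> j} = {}"
    then have none: "\<And>x. x \<in> T \<Longrightarrow> \<not> x \<le> j" by blast
    have "?d v = 0" if "v \<le> j" for v
      using that by (induction v) (use none assms(3) in fastforce)+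
    from this[of j] have "?d (Suc j) = - 1" using none assms(2) by auto
    then show False using assms(1) unfolding ballot_def by (metis neg_0_le_iff_le not_one_le_zero)
  qed
  then have "t \<in> {x \<in> T. x \<le> j}" unfolding assms(4) by (intro Max_in) auto
  then show tT: "t \<in> T" and tj: "t \<le> j" by auto
  have max: "x \<le> t" if "x \<in> T" "x \<le> j" for x
    unfolding assms(4) using that by (intro Max_ge) auto
  have d1: "?d1 v = ?d v - of_bool (t < v) + of_bool (j < v)" for v
    by (rule excess_remove_pair[OF tT assms(2)])
  have free: "v \<le> b" if "v \<le> j" "b \<in> B" for v b
    using assms(3)[OF that(2)] that(1) by simp
  have "0 \<le> ?d1 v" for v
  proof (cases "t < v \<and> v \<le> j")
    case True
    then have "?d t < ?d v" using free tT by (intro excess_less_free) auto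
    then show ?thesis using assms(1) True d1[of v] unfolding ballot_def by (smt (verit) of_bool_eq)
  next
    case False
    then show ?thesis using assms(1) d1[of v] tj unfolding ballot_def by auto
  qed
  then show "ballot (T - {t}) (B - {j})" by (simp add: ballot_def)
  \<comment> \<open>No element of the top row lies between \<open>t\<close> and \<open>j\<close>, and \<open>j\<close> closes the bracket of \<open>t\<close>.\<close>
  have flat: "?d (Suc j) \<le> ?d t"
  proof -
    have "?d1 v \<le> ?d t" if "t \<le> v" "v \<le> j" for v
      using that
    proof (induction v rule: dec_induct)
      case base then show ?case using d1[of t] tj by simp
    next
      case (step n)
      then have "n \<notin> T - {t}" using max[of n] by auto
      then have "?d1 (Suc n) \<le> ?d1 n" by (simp del: Diff_iff)
      also have "\<dots> \<le> ?d t" using step by simp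
      finally show ?case .
    qed
    from this[of j] tj have "?d1 (Suc j) \<le> ?d t" using max[of j] by auto
    then show ?thesis using d1[of "Suc j"] tj by simp
  qed
  have other: "u \<in> matched T B \<longleftrightarrow> u \<in> matched (T - {t}) (B - {j})" if u: "u \<in> T" "u \<noteq> t" for u
  proof (cases "u < t")
    case True
    have "?d w \<le> ?d u \<longleftrightarrow> ?d1 w \<le> ?d1 u" if "u < w" for w
    proof (cases "w \<le> j")
      case True
      have "?d u < ?d w" using free[OF True] that u by (intro excess_less_free) auto
      moreover have "?d1 u < ?d1 w" using free[OF True] that u by (intro excess_less_free) auto
      ultimately show ?thesis by simp
    next
      case False
      then show ?thesis using d1[of w] d1[of u] \<open>u < t\<close> tj by auto
    qed
    then show ?thesis using u unfolding matched_def by auto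
  next
    case False
    then have "j < u" using max[of u] u by linarith
    then have "?d w \<le> ?d u \<longleftrightarrow> ?d1 w \<le> ?d1 u" if "u < w" for w
      using d1[of w] d1[of u] tj that by auto
    then show ?thesis using u unfolding matched_def by auto
  qed
  have "t \<in> matched T B" unfolding matched_def using tT flat tj by (auto intro!: exI[of _ "Suc j"])
  moreover have "matched T B \<subseteq> T" "matched (T - {t}) (B - {j}) \<subseteq> T - {t}" by (auto simp: matched_def)
  ultimately show "matched T B = insert t (matched (T - {t}) (B - {j}))" using other by blast
qed

lemma theta_pairs_images:
  assumes "ballot T (set js)" "sorted_wrt (<) js"
  shows "fst ` {(j, t) \<in> set (theta_pairs T js). t \<noteq> j} = set js - T \<and>
    snd ` {(j, t) \<in> set (theta_pairs T js). t \<noteq> j} = matched T (set js) - set js"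
  using assms
proof (induction js arbitrary: T)
  case Nil
  have "excess T {} u < excess T {} w" if "u \<in> T" "u < w" for u w
    using that by (intro excess_less_free) auto
  then have "matched T {} = {}" unfolding matched_def by (auto simp: not_le)
  then show ?case by simp
next
  case (Cons j js)
  define t where "t = Max {x \<in> T. x \<le> j}"
  define P where "P = {(j', t') \<in> set (theta_pairs (T - {t}) js). t' \<noteq> j'}"
  let ?B = "set (j # js)"
  have B1: "?B - {j} = set js" using Cons.prems(2) by auto
  have min: "\<And>b. b \<in> ?B \<Longrightarrow> j \<le> b" using Cons.prems(2) by auto
  have tT: "t \<in> T" and tj: "t \<le> j" and bal: "ballot (T - {t}) (set js)"
    and M: "matched T ?B = insert t (matched (T - {t}) (set js))"
    using theta_step[OF Cons.prems(1) _ min t_def] B1 by auto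
  have max: "x \<le> t" if "x \<in> T" "x \<le> j" for x
    unfolding t_def using that by (intro Max_ge) auto
  have srt: "sorted_wrt (<) js" using Cons.prems(2) by simp
  have IH: "fst ` P = set js - (T - {t})" "snd ` P = matched (T - {t}) (set js) - set js"
    using Cons.IH[OF bal srt] unfolding P_def by blast+
  have sub: "matched (T - {t}) (set js) \<subseteq> T - {t}" by (auto simp: matched_def)
  have pairs: "{(j', t') \<in> set (theta_pairs T (j # js)). t' \<noteq> j'} =
      (if t = j then P else insert (j, t) P)"
    unfolding P_def by (auto simp: t_def[symmetric] Let_def)
  show ?case
  proof (cases "t = j")
    case True
    then show ?thesis unfolding pairs M using IH sub tT Cons.prems(2) by auto
  next
    case False
    then have "j \<notin> T" using max[of j] tj by auto
    moreover have "t \<notin> ?B" using min[of t] tj False by auto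
    ultimately show ?thesis unfolding pairs M using IH sub False tT by auto
  qed
qed

lemma matched_subset: "matched T B \<subseteq> T"
  by (auto simp: matched_def)

lemma Int_subset_matched: "T \<inter> B \<subseteq> matched T B"
  by (auto simp: matched_def intro!: exI[of _ "Suc _"])

text \<open>The exchange map sends the rows \<open>(T, B)\<close> to the unmatched part of \<open>T\<close> together with all of \<open>B\<close>,
  and to the matched part of \<open>T\<close>. Common elements of the rows are matched with themselves, which
  is why leaving them in place has the same effect as exchanging them.\<close>

theorem exchange_pairs_eq:
  assumes "ballot T B" "finite B"
  shows "exchange_pairs (T, B) = ((T - matched T B) \<union> B, matched T B)"
proof -
  have "fst ` symbol_pairs (T, B) = B - T" "snd ` symbol_pairs (T, B) = matched T B - B"
    using theta_pairs_images[of T "sorted_list_of_set B"] assms unfolding symbol_pairs_def by auto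
  then show ?thesis
    using matched_subset[of T B] Int_subset_matched[of T B] unfolding exchange_pairs_def by auto
qed

section \<open>Moving one entry of a row\<close>

text \<open>The letter of a row at coordinate \<open>x\<close>: \<open>-1\<close> if an entry can be moved from \<open>x - 1\<close> to \<open>x\<close> (an
  addable node), \<open>1\<close> if it can be moved back (a removable node). Every node has a positive
  coordinate, so 0 carries no letter.\<close>

fun letter :: "nat set \<Rightarrow> nat \<Rightarrow> int" where
  "letter X 0 = 0"
| "letter X (Suc y) = of_bool (Suc y \<in> X) - of_bool (y \<in> X)"

lemma letter_Suc_iff:
  "letter X (Suc y) = - 1 \<longleftrightarrow> y \<in> X \<and> Suc y \<notin> X"
  "letter X (Suc y) = 1 \<longleftrightarrow> y \<notin> X \<and> Suc y \<in> X"
  by auto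

text \<open>Adding a node moves one entry of a row by one.\<close>

definition slide :: "nat \<Rightarrow> nat set \<Rightarrow> nat set" where
  "slide y X = insert (Suc y) (X - {y})"

abbreviation top_row :: "nat set \<Rightarrow> nat set \<Rightarrow> nat set" where
  "top_row T B \<equiv> (T - matched T B) \<union> B"

lemma excess_slide_bottom:
  assumes "y \<in> B" "Suc y \<notin> B"
  shows "excess T (slide y B) v = excess T B v + of_bool (v = Suc y)"
  using assms by (induction v) (auto simp: slide_def)

lemma excess_slide_top:
  assumes "y \<in> T" "Suc y \<notin> T"
  shows "excess (slide y T) B v = excess T B v - of_bool (v = Suc y)"
  using assms by (induction v) (auto simp: slide_def)

text \<open>Beyond \<open>v\<close> the excess is not affected by moving an entry from \<open>v - 1\<close> to \<open>v\<close>, so this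
  predicate is all that is needed to compare \<open>matched\<close> before and after such a move.\<close>

definition drops_to :: "nat set \<Rightarrow> nat set \<Rightarrow> nat \<Rightarrow> int \<Rightarrow> bool" where
  "drops_to T B v k \<longleftrightarrow> (\<exists>w>v. excess T B w \<le> k)"

lemma drops_to_mono: "drops_to T B v k \<Longrightarrow> k \<le> l \<Longrightarrow> drops_to T B v l"
  unfolding drops_to_def using order_trans by blast

lemma drops_to_Suc: "drops_to T B v (excess T B (Suc v))"
  unfolding drops_to_def by blast

lemma matched_local:
  "y \<in> matched T B \<longleftrightarrow>
     y \<in> T \<and> (excess T B (Suc y) \<le> excess T B y \<or> drops_to T B (Suc y) (excess T B y))"
  "Suc y \<in> matched T B \<longleftrightarrow> Suc y \<in> T \<and> drops_to T B (Suc y) (excess T B (Suc y))"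
proof -
  have "(\<exists>w>y. excess T B w \<le> k) \<longleftrightarrow>
      excess T B (Suc y) \<le> k \<or> (\<exists>w>Suc y. excess T B w \<le> k)" for k
    by (metis Suc_lessI Suc_lessD lessI)
  then show "y \<in> matched T B \<longleftrightarrow>
     y \<in> T \<and> (excess T B (Suc y) \<le> excess T B y \<or> drops_to T B (Suc y) (excess T B y))"
    unfolding matched_def drops_to_def mem_Collect_eq by (simp only:)
qed (auto simp: matched_def drops_to_def)

text \<open>The exchange preserves the multiset of entries, hence the total sign at every coordinate. If
  only the entries \<open>x - 1\<close> of the first row and \<open>x\<close> of the second occur, the two are neighbouring
  brackets in the rows \<open>T\<close>, \<open>B\<close> and are matched with each other; in the exchanged rows, read in
  the order bottom before top, the entries show the same pattern. So the words \<open>AR\<close>, and with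
  them all reduced words at \<open>x\<close>, correspond.\<close>

lemma letter_exchange:
  "letter (matched T B) x + letter (top_row T B) x = letter T x + letter B x"
  "letter T x = - 1 \<and> letter B x = 1 \<longleftrightarrow> letter (matched T B) x = - 1 \<and> letter (top_row T B) x = 1"
proof -
  have *: "of_bool (v \<in> matched T B) + of_bool (v \<in> top_row T B) = of_bool (v \<in> T) + (of_bool (v \<in> B) :: int)" for v
    using matched_subset[of T B] Int_subset_matched[of T B] by (auto simp: of_bool_def)
  show 1: "letter (matched T B) x + letter (top_row T B) x = letter T x + letter B x"
  proof (cases x)
    case (Suc y)
    then show ?thesis using *[of y] *[of "Suc y"] by simp
  qed simp
  show "letter T x = - 1 \<and> letter B x = 1 \<longleftrightarrow> letter (matched T B) x = - 1 \<and> letter (top_row T B) x = 1"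
  proof (cases x)
    case (Suc y)
    let ?k = "excess T B y"
    have mono: "drops_to T B (Suc y) ?k \<Longrightarrow> drops_to T B (Suc y) (?k + 1)"
      by (erule drops_to_mono) simp
    show ?thesis unfolding Suc letter_Suc_iff
      by (cases "y \<in> T"; cases "y \<in> B"; cases "Suc y \<in> T"; cases "Suc y \<in> B")
        (use mono drops_to_Suc[of T B "Suc y"] in \<open>auto simp: matched_local[of y T B]\<close>)
  qed simp
qed

text \<open>Moving a bottom entry to the right can only increase the excess. A top entry moves only when the
  bottom row has no addable node at the same coordinate; then the excess at \<open>Suc y\<close> is positive,
  so it can drop by one.\<close>

lemma ballot_slide:
  assumes "ballot T B"
  shows "y \<in> B \<Longrightarrow> Suc y \<notin> B \<Longrightarrow> ballot T (slide y B)"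
    and "letter T (Suc y) = - 1 \<Longrightarrow> letter B (Suc y) \<noteq> - 1 \<Longrightarrow> ballot (slide y T) B"
proof -
  show "ballot T (slide y B)" if "y \<in> B" "Suc y \<notin> B"
    using assms excess_slide_bottom[OF that] unfolding ballot_def by simp
  show "ballot (slide y T) B" if l: "letter T (Suc y) = - 1" "letter B (Suc y) \<noteq> - 1"
  proof -
    have T: "y \<in> T" "Suc y \<notin> T" and B: "y \<in> B \<Longrightarrow> Suc y \<in> B" using l unfolding letter_Suc_iff by auto
    have "0 \<le> excess T B y" "0 \<le> excess T B (Suc (Suc y))" using assms unfolding ballot_def by blast+
    then have "1 \<le> excess T B (Suc y)" using T B by (cases "y \<in> B") auto
    then show ?thesis using assms excess_slide_top[OF T] unfolding ballot_def by auto
  qed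
qed

text \<open>The move changes the excess at \<open>Suc y\<close> alone. Whenever this value could decide whether some
  \<open>t < y\<close> is matched, a neighbouring value of the excess, at \<open>y\<close> or at \<open>Suc (Suc y)\<close>, is just as
  small and decides it too. The hypothesis says that the entry is moved as the crystal operator at
  \<open>Suc y\<close> prescribes: the letter of the top row precedes that of the bottom row, and the rightmost
  uncancelled \<open>A\<close> is turned into \<open>R\<close>.\<close>

lemma matched_slide_outside:
  assumes "letter T (Suc y) = - 1 \<and> letter B (Suc y) \<noteq> - 1 \<and> T' = slide y T \<and> B' = B \<or>
     letter B (Suc y) = - 1 \<and> letter T (Suc y) \<noteq> 1 \<and> T' = T \<and> B' = slide y B"
    and "t \<noteq> y" "t \<noteq> Suc y"
  shows "t \<in> matched T' B' \<longleftrightarrow> t \<in> matched T B"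
proof -
  let ?d = "excess T B" and ?d' = "excess T' B'"
  have same: "?d' w = ?d w" if "w \<noteq> Suc y" for w
    using assms(1) that excess_slide_bottom[of y B] excess_slide_top[of y T]
    unfolding letter_Suc_iff by auto
  have *: "(\<exists>w>t. ?d' w \<le> ?d t) \<longleftrightarrow> (\<exists>w>t. ?d w \<le> ?d t)"
  proof (cases "t < y")
    case True
    have eq: "(\<exists>w>t. f w \<le> (k::int)) \<longleftrightarrow> (\<exists>w>t. w \<noteq> Suc y \<and> f w \<le> k) \<or> f (Suc y) \<le> k" for f k
      using True less_SucI[of t y] by blast
    \<comment> \<open>\<open>y\<close> and \<open>Suc (Suc y)\<close> can replace the critical value \<open>Suc y\<close>.\<close>
    have nb: "(\<exists>w>t. w \<noteq> Suc y \<and> ?d w \<le> k)" if "?d y \<le> k \<or> ?d (Suc (Suc y)) \<le> k" for k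
      using that True by (metis less_Suc_eq n_not_Suc_n)
    have A: "(\<exists>w>t. w \<noteq> Suc y \<and> ?d' w \<le> k) \<longleftrightarrow> (\<exists>w>t. w \<noteq> Suc y \<and> ?d w \<le> k)" for k
      using same by auto
    from assms(1) show ?thesis
    proof (elim disjE conjE)
      assume l: "letter T (Suc y) = - 1" "letter B (Suc y) \<noteq> - 1" "T' = slide y T" "B' = B"
      have T: "y \<in> T" "Suc y \<notin> T" and B: "y \<in> B \<Longrightarrow> Suc y \<in> B" using l unfolding letter_Suc_iff by auto
      have "?d' (Suc y) = ?d (Suc y) - 1" unfolding l(3,4) excess_slide_top[OF T, of B] by (simp del: excess.simps)
      moreover have "?d y \<le> ?d (Suc y) - 1 \<or> ?d (Suc (Suc y)) \<le> ?d (Suc y) - 1"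
        using T B by (cases "y \<in> B") auto
      ultimately show ?thesis unfolding eq[of ?d'] eq[of ?d] A using nb[of "?d t"]
        by (auto simp del: excess.simps)
    next
      assume l: "letter B (Suc y) = - 1" "letter T (Suc y) \<noteq> 1" "T' = T" "B' = slide y B"
      have B: "y \<in> B" "Suc y \<notin> B" and T: "Suc y \<in> T \<Longrightarrow> y \<in> T" using l unfolding letter_Suc_iff by auto
      have "?d' (Suc y) = ?d (Suc y) + 1" unfolding l(3,4) excess_slide_bottom[OF B, of T] by (simp del: excess.simps)
      moreover have "?d y \<le> ?d (Suc y) \<or> ?d (Suc (Suc y)) \<le> ?d (Suc y)"
        using T B by (cases "y \<in> T") auto
      ultimately show ?thesis unfolding eq[of ?d'] eq[of ?d] A using nb[of "?d t"]
        by (auto simp del: excess.simps)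
    qed
  next
    case False
    then show ?thesis using same assms(2,3) by (metis Suc_leI leD linorder_neqE_nat)
  qed
  have "t \<in> T' \<longleftrightarrow> t \<in> T" using assms by (auto simp: slide_def)
  then show ?thesis using * same[OF assms(3)] unfolding matched_def by auto
qed

text \<open>The local form of the theorem: the exchange map intertwines the operator at \<open>Suc y\<close> for the
  order top before bottom with the operator for the order bottom before top. By the previous
  lemma only the entries \<open>y\<close> and \<open>Suc y\<close> have to be compared, case by case.\<close>

lemma exchange_slide:
  assumes move: "letter T (Suc y) = - 1 \<and> letter B (Suc y) \<noteq> - 1 \<and> T' = slide y T \<and> B' = B \<or>
     letter B (Suc y) = - 1 \<and> letter T (Suc y) \<noteq> 1 \<and> T' = T \<and> B' = slide y B"
  shows "letter (matched T B) (Suc y) = - 1 \<and> letter (top_row T B) (Suc y) \<noteq> - 1 \<Longrightarrow>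
      matched T' B' = slide y (matched T B) \<and> top_row T' B' = top_row T B"
    and "letter (top_row T B) (Suc y) = - 1 \<and> letter (matched T B) (Suc y) \<noteq> 1 \<Longrightarrow>
      matched T' B' = matched T B \<and> top_row T' B' = slide y (top_row T B)"
proof -
  let ?d = "excess T B" and ?d' = "excess T' B'"
  have out: "t \<in> matched T' B' \<longleftrightarrow> t \<in> matched T B" "t \<in> top_row T' B' \<longleftrightarrow> t \<in> top_row T B"
    if "t \<noteq> y" "t \<noteq> Suc y" for t
    using matched_slide_outside[OF move that] move that by (auto simp: slide_def)
  have same: "?d' w = ?d w" if "w \<noteq> Suc y" for w
    using move that excess_slide_bottom[of y B] excess_slide_top[of y T]
    unfolding letter_Suc_iff by auto
  have EE: "drops_to T' B' (Suc y) k = drops_to T B (Suc y) k" for k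
    unfolding drops_to_def using same by auto
  have d'y: "?d' y = ?d y" by (simp add: same)
  have d'Sy: "?d' (Suc y) = ?d y + of_bool (y \<in> T') - of_bool (y \<in> B')" by (simp add: d'y)
  have Es: "drops_to T B (Suc y) (?d y) \<Longrightarrow> drops_to T B (Suc y) (?d y + 1)"
    "drops_to T B (Suc y) (?d y - 1) \<Longrightarrow> drops_to T B (Suc y) (?d y)"
    "drops_to T B (Suc y) (?d y + 1) \<Longrightarrow> drops_to T B (Suc y) (?d y + 2)"
    by (auto elim: drops_to_mono)
  have mem: "y \<in> slide y X \<longleftrightarrow> False" "Suc y \<in> slide y X" for X by (auto simp: slide_def)
  have eqI: "X = slide y Z" if "y \<notin> X" "Suc y \<in> X" "\<And>t. t \<noteq> y \<Longrightarrow> t \<noteq> Suc y \<Longrightarrow> t \<in> X \<longleftrightarrow> t \<in> Z" for X Z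
  proof (rule set_eqI)
    show "t \<in> X \<longleftrightarrow> t \<in> slide y Z" for t
      using that(1,2) that(3)[of t] by (cases "t = y"; cases "t = Suc y") (auto simp: slide_def)
  qed
  have eqI2: "X = Z" if "y \<in> X \<longleftrightarrow> y \<in> Z" "Suc y \<in> X \<longleftrightarrow> Suc y \<in> Z" "\<And>t. t \<noteq> y \<Longrightarrow> t \<noteq> Suc y \<Longrightarrow> t \<in> X \<longleftrightarrow> t \<in> Z" for X Z
  proof (rule set_eqI)
    show "t \<in> X \<longleftrightarrow> t \<in> Z" for t
      using that(1,2) that(3)[of t] by (cases "t = y"; cases "t = Suc y") auto
  qed
  note facts = drops_to_Suc[of T B "Suc y"] matched_local[of y T B]
    matched_local[of y T' B', unfolded EE d'y d'Sy]
  show "matched T' B' = slide y (matched T B) \<and> top_row T' B' = top_row T B"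
    if "letter (matched T B) (Suc y) = - 1 \<and> letter (top_row T B) (Suc y) \<noteq> - 1"
  proof -
    have "y \<notin> matched T' B' \<and> Suc y \<in> matched T' B' \<and> (y \<in> top_row T' B' \<longleftrightarrow> y \<in> top_row T B) \<and>
      (Suc y \<in> top_row T' B' \<longleftrightarrow> Suc y \<in> top_row T B)"
      using move that facts Es unfolding letter_Suc_iff
      by (cases "y \<in> T"; cases "y \<in> B"; cases "Suc y \<in> T"; cases "Suc y \<in> B") (auto simp: mem algebra_simps)
    then show ?thesis using out by (intro conjI eqI eqI2) blast+
  qed
  show "matched T' B' = matched T B \<and> top_row T' B' = slide y (top_row T B)"
    if "letter (top_row T B) (Suc y) = - 1 \<and> letter (matched T B) (Suc y) \<noteq> 1"
  proof -
    have "y \<notin> top_row T' B' \<and> Suc y \<in> top_row T' B' \<and> (y \<in> matched T' B' \<longleftrightarrow> y \<in> matched T B) \<and>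
      (Suc y \<in> matched T' B' \<longleftrightarrow> Suc y \<in> matched T B)"
      using move that facts Es unfolding letter_Suc_iff
      by (cases "y \<in> T"; cases "y \<in> B"; cases "Suc y \<in> T"; cases "Suc y \<in> B") (auto simp: mem algebra_simps)
    then show ?thesis using out by (intro conjI eqI eqI2) blast+
  qed
qed

section \<open>Nodes and rows of symbols\<close>

lemma part_0 [simp]: "part p 0 = 0"
  by (simp add: part_def)

lemma part_beyond: "length p < a \<Longrightarrow> part p a = 0"
  by (simp add: part_def)

lemma part_pos_iff: "is_partition p \<Longrightarrow> 0 < part p a \<longleftrightarrow> 1 \<le> a \<and> a \<le> length p"
  unfolding is_partition_def part_def by (auto simp: in_set_conv_nth)

lemma part_antimono: "is_partition p \<Longrightarrow> 1 \<le> a \<Longrightarrow> a \<le> a' \<Longrightarrow> part p a' \<le> part p a"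
  unfolding is_partition_def part_def sorted_wrt_iff_nth_less
  by (cases "a = a'") (auto simp: less_diff_conv2 intro!: diff_less_mono)

lemma partition_eqI:
  assumes "is_partition p" "is_partition q" "\<And>a. 1 \<le> a \<Longrightarrow> part p a = part q a"
  shows "p = q"
proof (rule nth_equalityI)
  have "1 \<le> a \<and> a \<le> length p \<longleftrightarrow> 1 \<le> a \<and> a \<le> length q" for a
    using part_pos_iff[OF assms(1), of a] part_pos_iff[OF assms(2), of a] assms(3)[of a] by auto
  from this[of "length p"] this[of "length q"] show "length p = length q"
    by (cases "length p"; cases "length q") auto
  then show "p ! k = q ! k" if "k < length p" for k
    using assms(3)[of "Suc k"] that by (simp add: part_def)
qed

text \<open>Adding or removing a node changes one value of \<open>part\<close>; this lemma turns the changed function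
  back into a partition.\<close>

lemma partition_exists:
  assumes "\<And>a. 1 \<le> a \<Longrightarrow> f (Suc a) \<le> f a" "f 0 = 0" "\<And>a. N < a \<Longrightarrow> f a = (0::nat)"
  obtains p where "is_partition p" "part p = f"
proof
  have anti: "f b \<le> f a" if "1 \<le> a" "a \<le> b" for a b
    using that(2,1)
  proof (induction b rule: dec_induct)
    case (step n)
    then show ?case using assms(1)[of n] by linarith
  qed simp
  define n where "n = (LEAST n. \<forall>a>n. f a = 0)"
  have n: "\<forall>a>n. f a = 0" unfolding n_def by (rule LeastI[of _ N]) (use assms(3) in blast)
  have pos: "0 < f a" if "1 \<le> a" "a \<le> n" for a
  proof (rule ccontr)
    assume "\<not> 0 < f a"
    then have "\<forall>b>a - 1. f b = 0" using anti[of a] that by (metis One_nat_def Suc_leI Suc_pred gr0I le_zero_eq less_le_trans zero_less_one)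
    then have "n \<le> a - 1" unfolding n_def by (rule Least_le)
    then show False using that by simp
  qed
  let ?p = "map f [1..<Suc n]"
  show "is_partition ?p" unfolding is_partition_def sorted_wrt_iff_nth_less
    using anti pos by (fastforce simp del: upt_Suc)
  show "part ?p = f"
  proof
    fix a
    show "part ?p a = f a"
      using n assms(2) by (cases a) (auto simp: part_def simp del: upt_Suc)
  qed
qed

lemma bipartition_pick: "is_bipartition la \<Longrightarrow> is_partition (pick la c)"
  by (simp add: is_bipartition_def pick_def)

lemma diagram_iff: "(a, b, c) \<in> diagram la \<longleftrightarrow> c \<le> 1 \<and> 1 \<le> a \<and> 1 \<le> b \<and> b \<le> part (pick la c) a"
  by (auto simp: diagram_def)

lemma adds_node_iff:
  "adds_node la (a, b, c) mu \<longleftrightarrow> is_bipartition la \<and> is_bipartition mu \<and> c \<le> 1 \<and> 1 \<le> a \<and>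
     b = Suc (part (pick la c) a) \<and> part (pick mu c) = (part (pick la c))(a := b) \<and>
     pick mu (1 - c) = pick la (1 - c)" (is "?L \<longleftrightarrow> ?R")
proof
  assume L: ?L
  then have la: "is_bipartition la" and mu: "is_bipartition mu" and "(a, b, c) \<notin> diagram la"
    and dia: "diagram mu = diagram la \<union> {(a, b, c)}" by (auto simp: adds_node_def)
  moreover have "(a, b, c) \<in> diagram mu" unfolding dia by simp
  ultimately have abc: "c \<le> 1" "1 \<le> a" "part (pick la c) a < b" "b \<le> part (pick mu c) a"
    unfolding diagram_iff by auto
  have mem: "1 \<le> k \<and> k \<le> part (pick mu c') a' \<longleftrightarrow>
      1 \<le> k \<and> k \<le> part (pick la c') a' \<or> (a', k, c') = (a, b, c)" if "c' \<le> 1" "1 \<le> a'" for a' k c'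
  proof -
    have "(a', k, c') \<in> diagram mu \<longleftrightarrow> (a', k, c') \<in> diagram la \<union> {(a, b, c)}" using dia by simp
    then show ?thesis using that by (auto simp: diagram_iff)
  qed
  have same: "part (pick mu c') a' = part (pick la c') a'" if "c' \<le> 1" "1 \<le> a'" "(a', c') \<noteq> (a, c)" for a' c'
    using mem[OF that(1,2), of "part (pick mu c') a'"] mem[OF that(1,2), of "part (pick la c') a'"] that(3)
    by auto
  have b: "b = Suc (part (pick la c) a)"
    using mem[OF abc(1,2), of "Suc (part (pick la c) a)"] abc by auto
  have "part (pick mu c) a = b"
    using mem[OF abc(1,2), of "part (pick mu c) a"] abc by auto
  then have "part (pick mu c) a' = ((part (pick la c))(a := b)) a'" for a'
    using same[of c a'] abc by (cases "a' = 0") auto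
  moreover have "pick mu (1 - c) = pick la (1 - c)"
  proof (intro partition_eqI bipartition_pick la mu)
    fix k :: nat assume "1 \<le> k"
    moreover have "1 - c \<noteq> c" by presburger
    ultimately show "part (pick mu (1 - c)) k = part (pick la (1 - c)) k" using same[of "1 - c" k] by simp
  qed
  ultimately show ?R using la mu abc b by auto
next
  assume R: ?R
  have "(a', k, c') \<in> diagram mu \<longleftrightarrow> (a', k, c') \<in> diagram la \<union> {(a, b, c)}" for a' k c'
  proof (cases "c' = c")
    case True
    then show ?thesis using R by (auto simp: diagram_iff)
  next
    case False
    then have "c' = 1 - c \<or> \<not> c' \<le> 1" using R by auto
    then show ?thesis using R False by (auto simp: diagram_iff)
  qed
  then have "diagram mu = diagram la \<union> {(a, b, c)}" by auto
  moreover have "(a, b, c) \<notin> diagram la" using R by (auto simp: diagram_iff)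
  ultimately show ?L using R by (auto simp: adds_node_def)
qed

lemma bipartition_eqI: "pick la c = pick mu c \<Longrightarrow> pick la (1 - c) = pick mu (1 - c) \<Longrightarrow> c \<le> 1 \<Longrightarrow> la = mu"
  by (cases c) (auto simp: pick_def intro: prod_eqI)

lemma adds_node_unique:
  assumes "adds_node la g mu" "adds_node la g mu'"
  shows "mu = mu'"
proof -
  obtain a b c where g: "g = (a, b, c)" by (cases g)
  from assms have R: "is_bipartition mu" "is_bipartition mu'" "c \<le> 1"
    "part (pick mu c) = part (pick mu' c)" "pick mu (1 - c) = pick mu' (1 - c)"
    unfolding g adds_node_iff by auto
  then have "pick mu c = pick mu' c" by (intro partition_eqI bipartition_pick) simp_all
  then show ?thesis using R by (intro bipartition_eqI[of mu c mu']) simp_all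
qed

definition subst_component :: "bipartition \<Rightarrow> nat \<Rightarrow> nat list \<Rightarrow> bipartition" where
  "subst_component la c p = (if c = 0 then (p, snd la) else (fst la, p))"

lemma subst_component:
  assumes "c \<le> 1" "is_bipartition la" "is_partition p"
  shows "pick (subst_component la c p) c = p" "pick (subst_component la c p) (1 - c) = pick la (1 - c)"
    "is_bipartition (subst_component la c p)"
  using assms by (auto simp: subst_component_def pick_def is_bipartition_def)

lemma addable_iff:
  assumes la: "is_bipartition la"
  shows "addable la (a, b, c) \<longleftrightarrow> c \<le> 1 \<and> 1 \<le> a \<and> b = Suc (part (pick la c) a) \<and>
     (a = 1 \<or> part (pick la c) a < part (pick la c) (a - 1))" (is "_ \<longleftrightarrow> ?R")
proof
  assume "addable la (a, b, c)"
  then obtain mu where mu: "adds_node la (a, b, c) mu" by (auto simp: addable_def)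
  then have R: "is_bipartition mu" "c \<le> 1" "1 \<le> a" "b = Suc (part (pick la c) a)"
    "part (pick mu c) = (part (pick la c))(a := b)" unfolding adds_node_iff by auto
  then have "b \<le> part (pick la c) (a - 1)" if "a \<noteq> 1"
    using part_antimono[OF bipartition_pick[OF R(1)], of "a - 1" a c] that R(3) unfolding R(5)
    by (cases "a - 1 = a") auto
  then have "part (pick la c) a < part (pick la c) (a - 1)" if "a \<noteq> 1" using that R(4) by simp
  then show ?R using R by blast
next
  assume R: ?R
  let ?p = "pick la c"
  have p: "is_partition ?p" using la by (rule bipartition_pick)
  obtain q where q: "is_partition q" "part q = (part ?p)(a := b)"
  proof (rule partition_exists[of "(part ?p)(a := b)" "length ?p + a"])
    fix k :: nat assume "1 \<le> k"
    then have "part ?p (Suc k) \<le> part ?p k" using part_antimono[OF p] by simp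
    then show "((part ?p)(a := b)) (Suc k) \<le> ((part ?p)(a := b)) k" using R \<open>1 \<le> k\<close> by auto
  qed (use R in \<open>auto simp: part_beyond\<close>)
  then have "adds_node la (a, b, c) (subst_component la c q)"
    unfolding adds_node_iff using R la subst_component[of c la q] by auto
  then show "addable la (a, b, c)" unfolding addable_def by blast
qed

lemma removable_iff:
  assumes la: "is_bipartition la"
  shows "removable la (a, b, c) \<longleftrightarrow> c \<le> 1 \<and> 1 \<le> a \<and> b = part (pick la c) a \<and>
     part (pick la c) (Suc a) < part (pick la c) a" (is "_ \<longleftrightarrow> ?R")
proof
  assume "removable la (a, b, c)"
  then obtain mu where mu: "adds_node mu (a, b, c) la" by (auto simp: removable_def)
  then show ?R unfolding adds_node_iff
    using part_antimono[OF bipartition_pick[of mu c], of a "Suc a"] by auto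
next
  assume R: ?R
  let ?p = "pick la c"
  have p: "is_partition ?p" using la by (rule bipartition_pick)
  obtain q where q: "is_partition q" "part q = (part ?p)(a := b - 1)"
  proof (rule partition_exists[of "(part ?p)(a := b - 1)" "length ?p + a"])
    fix k :: nat assume "1 \<le> k"
    then have "part ?p (Suc k) \<le> part ?p k" using part_antimono[OF p] by simp
    then show "((part ?p)(a := b - 1)) (Suc k) \<le> ((part ?p)(a := b - 1)) k" using R \<open>1 \<le> k\<close> by auto
  qed (use R in \<open>auto simp: part_beyond\<close>)
  then have "adds_node (subst_component la c q) (a, b, c) la"
    unfolding adds_node_iff using R la subst_component[of c la q] by auto
  then show "removable la (a, b, c)" unfolding removable_def by blast
qed

text \<open>The entry of row \<open>a\<close> of a partition in a symbol row of cardinality \<open>M\<close>.\<close>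

definition beta :: "nat \<Rightarrow> nat list \<Rightarrow> nat \<Rightarrow> nat" where
  "beta M p a = part p a + M - a"

definition beta_set :: "nat \<Rightarrow> nat list \<Rightarrow> nat set" where
  "beta_set M p = beta M p ` {1..M}"

lemma beta_less:
  assumes "is_partition p" "1 \<le> a" "a < a'" "a' \<le> M"
  shows "beta M p a' < beta M p a"
  using part_antimono[OF assms(1,2), of a'] assms by (simp add: beta_def)

lemma beta_inj: "is_partition p \<Longrightarrow> inj_on (beta M p) {1..M}"
  by (intro linorder_inj_onI') (metis atLeastAtMost_iff beta_less less_irrefl)

text \<open>The entry after \<open>beta M p a\<close> is vacant iff row \<open>a\<close> is shorter than the row before it, because
  the entries decrease strictly along the rows.\<close>

lemma letter_addable:
  assumes p: "is_partition p"
  shows "letter (beta_set M p) x = - 1 \<longleftrightarrow>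
    (\<exists>a. 1 \<le> a \<and> a \<le> M \<and> x = Suc (beta M p a) \<and> (a = 1 \<or> part p a < part p (a - 1)))"
    (is "?L \<longleftrightarrow> ?R")
proof
  assume ?L
  then obtain y where x: "x = Suc y" by (cases x) auto
  then have y: "y \<in> beta_set M p" "Suc y \<notin> beta_set M p" using \<open>?L\<close> letter_Suc_iff by auto
  then obtain a where a: "1 \<le> a" "a \<le> M" "y = beta M p a" by (auto simp: beta_set_def)
  have "part p a < part p (a - 1)" if "a \<noteq> 1"
  proof (rule ccontr)
    assume "\<not> ?thesis"
    then have "part p (a - 1) = part p a" using part_antimono[OF p, of "a - 1" a] a that by auto
    then have "Suc y = beta M p (a - 1)" using a that by (auto simp: beta_def)
    moreover have "a - 1 \<in> {1..M}" using a that by auto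
    ultimately show False using y(2) unfolding beta_set_def by blast
  qed
  then show ?R using a x by blast
next
  assume ?R
  then obtain a where a: "1 \<le> a" "a \<le> M" "x = Suc (beta M p a)" "a = 1 \<or> part p a < part p (a - 1)" by blast
  have "x \<noteq> beta M p a'" if a': "1 \<le> a'" "a' \<le> M" for a'
  proof
    assume eq: "x = beta M p a'"
    have "a' < a"
    proof (rule ccontr)
      assume "\<not> a' < a"
      then show False using beta_less[OF p a(1), of a' M] a' eq a(3) by (cases "a = a'") auto
    qed
    then have "part p (a - 1) \<le> part p a'" using part_antimono[OF p a'(1), of "a - 1"] by simp
    then show False using eq a a' \<open>a' < a\<close> by (auto simp: beta_def)
  qed
  then have "x \<notin> beta_set M p" by (fastforce simp: beta_set_def)
  moreover have "beta M p a \<in> beta_set M p" using a by (auto simp: beta_set_def)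
  ultimately show ?L using a(3) letter_Suc_iff by auto
qed

lemma letter_removable:
  assumes p: "is_partition p" and len: "length p < M"
  shows "letter (beta_set M p) x = 1 \<longleftrightarrow>
    (\<exists>a. 1 \<le> a \<and> a \<le> M \<and> x = beta M p a \<and> part p (Suc a) < part p a)"
    (is "?L \<longleftrightarrow> ?R")
proof
  assume ?L
  then obtain y where x: "x = Suc y" by (cases x) auto
  then have y: "y \<notin> beta_set M p" "Suc y \<in> beta_set M p" using \<open>?L\<close> letter_Suc_iff by auto
  then obtain a where a: "1 \<le> a" "a \<le> M" "Suc y = beta M p a" by (auto simp: beta_set_def)
  have "part p (Suc a) < part p a"
  proof (rule ccontr)
    assume "\<not> ?thesis"
    then have eq: "part p (Suc a) = part p a" using part_antimono[OF p, of a "Suc a"] a by auto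
    have "a \<noteq> M" using a(3) part_beyond[OF len] by (auto simp: beta_def)
    then have "y = beta M p (Suc a)" "Suc a \<le> M" using a eq by (auto simp: beta_def)
    then show False using y by (auto simp: beta_set_def)
  qed
  then show ?R using a x by auto
next
  assume ?R
  then obtain a where a: "1 \<le> a" "a \<le> M" "x = beta M p a" "part p (Suc a) < part p a" by blast
  then have "0 < x" by (simp add: beta_def)
  then obtain y where x: "x = Suc y" by (cases x) simp_all
  have "y \<noteq> beta M p a'" if a': "1 \<le> a'" "a' \<le> M" for a'
  proof
    assume eq: "y = beta M p a'"
    have "a < a'"
    proof (rule ccontr)
      assume "\<not> a < a'"
      then show False using beta_less[OF p a'(1), of a M] a eq x by (cases "a = a'") auto
    qed
    then have "part p a' \<le> part p (Suc a)" using part_antimono[OF p, of "Suc a" a'] by simp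
    then show False using eq a a' x \<open>a < a'\<close> by (auto simp: beta_def)
  qed
  then have "y \<notin> beta_set M p" by (fastforce simp: beta_set_def)
  moreover have "Suc y \<in> beta_set M p" using a x by (auto simp: beta_set_def)
  ultimately show ?L using x letter_Suc_iff by auto
qed

lemma beta_set_add:
  assumes "is_partition p" "1 \<le> a" "a \<le> M" "part q = (part p)(a := Suc (part p a))"
  shows "beta_set M q = slide (beta M p a) (beta_set M p)"
proof -
  have q: "beta M q k = (if k = a then Suc (beta M p a) else beta M p k)" for k
    using assms by (auto simp: beta_def)
  have "{1..M} = insert a ({1..M} - {a})" using assms by auto
  then have "beta_set M q = insert (beta M q a) (beta M q ` ({1..M} - {a}))"
    unfolding beta_set_def by (metis image_insert)
  also have "\<dots> = insert (Suc (beta M p a)) (beta M p ` ({1..M} - {a}))" by (simp add: q)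
  also have "beta M p ` ({1..M} - {a}) = beta_set M p - {beta M p a}"
    unfolding beta_set_def using inj_on_image_set_diff[OF beta_inj[OF assms(1), of M], of "{1..M}" "{a}"] assms by simp
  finally show ?thesis by (simp add: slide_def)
qed

lemma zero_in_beta_set:
  assumes "is_partition p" shows "0 \<in> beta_set M p \<longleftrightarrow> length p < M"
proof
  assume "0 \<in> beta_set M p"
  then obtain a where a: "1 \<le> a" "a \<le> M" "part p a + M - a = 0" by (auto simp: beta_set_def beta_def)
  then have "a = M" by simp
  then show "length p < M" using part_pos_iff[OF assms, of M] a by auto
next
  assume "length p < M"
  then have "beta M p M = 0" by (simp add: beta_def part_beyond)
  then show "0 \<in> beta_set M p" using \<open>length p < M\<close> by (force simp: beta_set_def)
qed

text \<open>A row of the symbol, listed in decreasing order, recovers the parts one by one.\<close>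

lemma beta_set_inj:
  assumes p: "is_partition p" "length p < M" and q: "is_partition q" "length q < M"
    and eq: "beta_set M p = beta_set M q"
  shows "p = q"
proof -
  have list: "map (beta M r) (rev [1..<Suc M]) = sorted_list_of_set (beta_set M r)" if "is_partition r" for r
  proof (rule strict_sorted_equal)
    show "sorted_wrt (<) (map (beta M r) (rev [1..<Suc M]))"
      unfolding sorted_wrt_map sorted_wrt_rev
      by (rule sorted_wrt_mono_rel[OF _ sorted_wrt_upt]) (auto intro: beta_less[OF that])
    show "sorted_wrt (<) (sorted_list_of_set (beta_set M r))" by simp
    show "set (map (beta M r) (rev [1..<Suc M])) = set (sorted_list_of_set (beta_set M r))"
      by (auto simp: beta_set_def)
  qed
  have "map (beta M p) (rev [1..<Suc M]) = map (beta M q) (rev [1..<Suc M])"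
    using list[OF p(1)] list[OF q(1)] eq by simp
  then have b: "beta M p a = beta M q a" if "1 \<le> a" "a \<le> M" for a
    unfolding map_eq_conv using that by auto
  have "part p a = part q a" if "1 \<le> a" for a
  proof (cases "a \<le> M")
    case True
    then show ?thesis using b[OF that] by (simp add: beta_def)
  next
    case False
    then show ?thesis using p q by (simp add: part_beyond)
  qed
  then show ?thesis by (rule partition_eqI[OF p(1) q(1)])
qed

lemma sum_list_part: "length p \<le> N \<Longrightarrow> sum_list p = (\<Sum>a\<in>{1..N}. part p a)"
proof -
  assume "length p \<le> N"
  have "sum_list p = (\<Sum>k<length p. p ! k)" by (simp add: sum_list_sum_nth atLeast0LessThan)
  also have "\<dots> = (\<Sum>k<length p. part p (Suc k))" by (intro sum.cong) (auto simp: part_def)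
  also have "\<dots> = (\<Sum>k<N. part p (Suc k))"
    using \<open>length p \<le> N\<close> by (intro sum.mono_neutral_left) (auto simp: part_def)
  also have "\<dots> = (\<Sum>a\<in>{1..N}. part p a)" by (rule sum.reindex_bij_witness[of _ "\<lambda>a. a - 1" Suc]) auto
  finally show ?thesis .
qed

lemma bip_rank_add:
  assumes "adds_node la g mu" shows "bip_rank mu = Suc (bip_rank la)"
proof -
  obtain a b c where "g = (a, b, c)" by (cases g)
  with assms have R: "c \<le> 1" "1 \<le> a" "part (pick mu c) = (part (pick la c))(a := Suc (part (pick la c) a))"
     "pick mu (1 - c) = pick la (1 - c)" by (auto simp: adds_node_iff)
  define N where "N = length (pick la c) + length (pick mu c) + a"
  have ins: "{1..N} = insert a ({1..N} - {a})" using R by (auto simp: N_def)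
  have "sum_list (pick mu c) = (\<Sum>k\<in>{1..N}. part (pick mu c) k)" by (rule sum_list_part) (simp add: N_def)
  also have "\<dots> = Suc (part (pick la c) a) + (\<Sum>k\<in>{1..N} - {a}. part (pick la c) k)"
    by (subst ins, subst sum.insert) (auto simp: R intro!: sum.cong)
  also have "\<dots> = Suc (\<Sum>k\<in>insert a ({1..N} - {a}). part (pick la c) k)" by (subst sum.insert) auto
  also have "\<dots> = Suc (sum_list (pick la c))" unfolding ins[symmetric] by (subst sum_list_part[of _ N]) (auto simp: N_def)
  finally show ?thesis using R(1,4) by (cases c) (auto simp: bip_rank_def pick_def)
qed

lemma symbol_row_eq: "symbol_row s m la c = beta_set (m + pick s c) (pick la c)"
  unfolding symbol_row_def beta_set_def by (rule image_cong) (simp_all add: beta_def)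

lemma le_one_cases: "c \<le> 1 \<longleftrightarrow> c = 0 \<or> c = (1::nat)"
  by auto

lemma symbol_admissible_iff:
  "symbol_admissible s m la \<longleftrightarrow> (\<forall>c\<le>1. length (pick la c) < m + pick s c)"
proof -
  have "(\<forall>c\<le>1. length (pick la c) < m + pick s c) \<longleftrightarrow>
      length (fst la) < m + fst s \<and> length (snd la) < m + snd s"
    unfolding le_one_cases by (auto simp: pick_def)
  moreover have "symbol_admissible s m la \<longleftrightarrow>
      length (fst la) < m + fst s \<and> length (snd la) < m + snd s"
    unfolding symbol_admissible_def by auto
  ultimately show ?thesis by blast
qed

text \<open>The content of a node for the charge \<open>s\<close>, shifted by \<open>m\<close> so as to match the entries of the
  symbol. It is used for the raised charge \<open>(s\<^sub>0, s\<^sub>1 + e)\<close> as well.\<close>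

fun coordinate :: "nat \<times> nat \<Rightarrow> nat \<Rightarrow> node \<Rightarrow> nat" where
  "coordinate s m (a, b, c) = b + (m + pick s c) - a"

definition coordinates :: "nat \<times> nat \<Rightarrow> nat \<Rightarrow> node \<Rightarrow> nat \<times> nat" where
  "coordinates s m g = (coordinate s m g, node_component g)"

text \<open>Admissibility bounds the row index of the node by the cardinality of the symbol row, so the
  natural subtraction in the coordinate is exact.\<close>

lemma coordinate_node:
  assumes la: "is_bipartition la" and adm: "symbol_admissible s m la"
    and g: "addable la g \<or> removable la g"
  shows "int (coordinate s m g) = node_content (int (fst s), int (snd s)) g + int m"
    and "node_component g \<le> 1"
    and "letter (symbol_row s m la (node_component g)) (coordinate s m g) = node_sign la g"
proof -
  obtain a b c where abc: "g = (a, b, c)" by (cases g)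
  let ?p = "pick la c" and ?M = "m + pick s c"
  have p: "is_partition ?p" using la by (rule bipartition_pick)
  have c: "c \<le> 1" and a: "1 \<le> a" using g abc addable_iff[OF la] removable_iff[OF la] by auto
  then have len: "length ?p < ?M" using adm symbol_admissible_iff by blast
  have aM: "a \<le> ?M"
  proof (rule ccontr)
    assume "\<not> a \<le> ?M"
    then have "part ?p a = 0" "part ?p (a - 1) = 0" "a \<noteq> 1"
      using len by (auto intro!: part_beyond)
    then show False using g unfolding abc addable_iff[OF la] removable_iff[OF la] by auto
  qed
  show "int (coordinate s m g) = node_content (int (fst s), int (snd s)) g + int m"
    using aM by (auto simp: abc pick_def of_nat_diff)
  show "node_component g \<le> 1" using c abc by simp
  have "letter (symbol_row s m la c) (coordinate s m g) = - 1" if "addable la g"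
    unfolding symbol_row_eq letter_addable[OF p] using that aM
    unfolding abc addable_iff[OF la] by (auto simp: beta_def intro!: exI[of _ a])
  moreover have "letter (symbol_row s m la c) (coordinate s m g) = 1" if "removable la g"
    unfolding symbol_row_eq letter_removable[OF p len] using that aM
    unfolding abc removable_iff[OF la] by (auto simp: beta_def intro!: exI[of _ a])
  ultimately show "letter (symbol_row s m la (node_component g)) (coordinate s m g) = node_sign la g"
    using g not_addable_removable[of la g] by (auto simp: abc node_sign_def)
qed

lemma letter_range: "letter X x = - 1 \<or> letter X x = 0 \<or> letter X x = 1"
  by (cases x) auto

lemma node_of_letter:
  assumes la: "is_bipartition la" and adm: "symbol_admissible s m la" and c: "c \<le> 1"
    and l: "letter (symbol_row s m la c) x \<noteq> 0"
  obtains g where "addable la g \<or> removable la g" "coordinates s m g = (x, c)"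
proof -
  let ?p = "pick la c" and ?M = "m + pick s c"
  have p: "is_partition ?p" using la by (rule bipartition_pick)
  have len: "length ?p < ?M" using adm symbol_admissible_iff c by blast
  from l letter_range consider "letter (symbol_row s m la c) x = - 1" | "letter (symbol_row s m la c) x = 1"
    by blast
  then show thesis
  proof cases
    case 1
    then obtain a where "1 \<le> a" "a \<le> ?M" "x = Suc (beta ?M ?p a)" "a = 1 \<or> part ?p a < part ?p (a - 1)"
      unfolding symbol_row_eq letter_addable[OF p] by blast
    then show thesis using c addable_iff[OF la]
      by (intro that[of "(a, Suc (part ?p a), c)"]) (auto simp: coordinates_def beta_def)
  next
    case 2
    then obtain a where "1 \<le> a" "a \<le> ?M" "x = beta ?M ?p a" "part ?p (Suc a) < part ?p a"
      unfolding symbol_row_eq letter_removable[OF p len] by blast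
    then show thesis using c removable_iff[OF la]
      by (intro that[of "(a, part ?p a, c)"]) (auto simp: coordinates_def beta_def)
  qed
qed

text \<open>A node is determined by its diagonal within its component and by being addable or removable,
  and the letter at its coordinate tells which of the two holds.\<close>

lemma coordinates_inj:
  assumes la: "is_bipartition la" and adm: "symbol_admissible s m la"
  shows "inj_on (coordinates s m) {g. addable la g \<or> removable la g}"
proof (rule inj_onI)
  fix g h
  assume g: "g \<in> {g. addable la g \<or> removable la g}" and h: "h \<in> {g. addable la g \<or> removable la g}"
    and eq: "coordinates s m g = coordinates s m h"
  obtain a b c where abc: "g = (a, b, c)" by (cases g)
  obtain a' b' where abc': "h = (a', b', c)" using eq abc by (cases h) (auto simp: coordinates_def)
  have sign: "node_sign la g = node_sign la h"
    using coordinate_node(3)[OF la adm] g h eq by (metis coordinates_def mem_Collect_eq prod.inject)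
  have b: "b = part (pick la c) a + of_bool (addable la g)" "b' = part (pick la c) a' + of_bool (addable la g)"
    using g h sign not_addable_removable unfolding node_sign_def
    by (auto simp: abc abc' addable_iff[OF la] removable_iff[OF la] split: if_splits)
  have "int b - int a = int b' - int a'"
    using coordinate_node(1)[OF la adm, of g] coordinate_node(1)[OF la adm, of h] g h eq
    by (auto simp: abc abc' coordinates_def)
  moreover have "1 \<le> a" "1 \<le> a'" using g h by (auto simp: abc abc' addable_iff[OF la] removable_iff[OF la])
  ultimately have "a = a'" using b part_antimono[OF bipartition_pick[OF la], of a a' c]
      part_antimono[OF bipartition_pick[OF la], of a' a c] by linarith
  then show "g = h" using b abc abc' by simp
qed

text \<open>The Boolean selects the source or the target charge of \<open>\<Psi>\<close>, so that both crystals are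
  treated at once.\<close>

definition charge :: "bool \<Rightarrow> int \<Rightarrow> nat \<times> nat \<Rightarrow> int \<times> int" where
  "charge d e s = (int (fst s), int (snd s) + (if d then e else 0))"

text \<open>Two positions for each coordinate, one for each component. Raising \<open>s\<^sub>1\<close> by \<open>e\<close> moves component
  1 past exactly those nodes of component 0 with the same residue that lie at the same coordinate,
  so the two charges differ only in the order of the components at each coordinate.\<close>

definition position :: "bool \<Rightarrow> nat \<times> nat \<Rightarrow> nat \<Rightarrow> node \<Rightarrow> nat" where
  "position d s m g = 2 * coordinate s m g + (if d then node_component g else 1 - node_component g)"

definition interleave :: "int \<Rightarrow> nat \<Rightarrow> int \<Rightarrow> nat set \<Rightarrow> nat set \<Rightarrow> nat \<Rightarrow> int" where
  "interleave e m i X Y p = (if (int (p div 2) - int m) mod e = i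
     then letter (if even p then X else Y) (p div 2) else 0)"

definition signature :: "bool \<Rightarrow> int \<Rightarrow> nat \<times> nat \<Rightarrow> nat \<Rightarrow> int \<Rightarrow> bipartition \<Rightarrow> nat \<Rightarrow> int" where
  "signature d e s m i la = interleave e m i
     (symbol_row s m la (if d then 0 else 1)) (symbol_row s m la (if d then 1 else 0))"

lemma letter_finite: "finite X \<Longrightarrow> finite {x. letter X x \<noteq> 0}"
proof (rule finite_subset)
  show "{x. letter X x \<noteq> 0} \<subseteq> X \<union> Suc ` X"
  proof
    fix x assume "x \<in> {x. letter X x \<noteq> 0}"
    then show "x \<in> X \<union> Suc ` X" by (cases x) (auto split: if_splits)
  qed
qed simp

text \<open>For nodes of equal residue this makes the comparison of contents insensitive to shifting one of
  them by \<open>e\<close>, up to ties.\<close>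

lemma congruent_less_iff:
  fixes x y e :: int
  assumes "0 < e" "x mod e = y mod e"
  shows "x < y \<longleftrightarrow> x + e \<le> y"
proof
  assume "x < y"
  moreover have "e dvd y - x" using assms(2) by (metis mod_eq_dvd_iff)
  ultimately show "x + e \<le> y" using zdvd_imp_le[of e "y - x"] by simp
qed (use assms in auto)

lemma encodes_signature:
  assumes e: "0 < e" and la: "is_bipartition la" and adm: "symbol_admissible s m la"
  shows "encodes_signature e (charge d e s) la i (position d s m) (signature d e s m i la)"
proof -
  define W where "W = signature_nodes e (charge d e s) la i"
  define D where "D = {g. addable la g \<or> removable la g}"
  have content: "node_content (charge d e s) g = int (coordinate s m g) - int m +
      (if d \<and> node_component g = 1 then e else 0)" "node_component g \<le> 1" if "g \<in> D" for g
    using coordinate_node(1,2)[OF la adm, of g] that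
    by (cases g, auto simp: D_def charge_def pick_def le_one_cases)+
  then have res: "node_residue e (charge d e s) g = (int (coordinate s m g) - int m) mod e" if "g \<in> D" for g
    using that by (simp add: node_residue_def)
  have W: "g \<in> W \<longleftrightarrow> g \<in> D \<and> (int (coordinate s m g) - int m) mod e = i" for g
    using res[of g] by (auto simp: W_def D_def signature_nodes_def)
  have pos: "position d s m g div 2 = coordinate s m g"
      "even (position d s m g) \<longleftrightarrow> node_component g = (if d then 0 else 1)" if "g \<in> D" for g
    using content(2)[OF that] unfolding position_def le_one_cases by auto
  have inj: "inj_on (position d s m) W"
  proof (rule inj_onI)
    fix g h assume gh: "g \<in> W" "h \<in> W" and eq: "position d s m g = position d s m h"
    then have D: "g \<in> D" "h \<in> D" using W by auto
    have "coordinates s m g = coordinates s m h"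
      using pos[OF D(1)] pos[OF D(2)] eq content(2)[OF D(1)] content(2)[OF D(2)]
      by (auto simp: coordinates_def le_one_cases split: if_splits)
    then show "g = h" using inj_onD[OF coordinates_inj[OF la adm], of g h] D unfolding D_def by blast
  qed
  have less: "node_less (charge d e s) g h \<longleftrightarrow> position d s m g < position d s m h"
    if "g \<in> W" "h \<in> W" for g h
  proof -
    have D: "g \<in> D" "h \<in> D" using W that by auto
    let ?x = "int (coordinate s m g)" and ?y = "int (coordinate s m h)"
    have "(?x - int m) mod e = (?y - int m) mod e" using W that by simp
    then have xy: "?x < ?y \<longleftrightarrow> ?x + e \<le> ?y" "?y < ?x \<longleftrightarrow> ?y + e \<le> ?x"
      using congruent_less_iff[OF e, of "?x - int m" "?y - int m"]
        congruent_less_iff[OF e, of "?y - int m" "?x - int m"] by auto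
    have "position d s m g < position d s m h \<longleftrightarrow> ?x < ?y \<or> ?x = ?y \<and>
        (if d then node_component g < node_component h else node_component h < node_component g)"
      using content(2)[OF D(1)] content(2)[OF D(2)] unfolding position_def le_one_cases
      by (cases d) auto
    also have "\<dots> \<longleftrightarrow> node_less (charge d e s) g h"
      using content(2)[OF D(1)] content(2)[OF D(2)] xy e
      unfolding node_less_def content(1)[OF D(1)] content(1)[OF D(2)] le_one_cases
      by (cases d) auto
    finally show ?thesis ..
  qed
  have sign: "signature d e s m i la (position d s m g) = node_sign la g" if "g \<in> W" for g
  proof -
    have D: "g \<in> D" and i: "(int (coordinate s m g) - int m) mod e = i" using W that by auto
    have "signature d e s m i la (position d s m g) = letter (symbol_row s m la (node_component g)) (coordinate s m g)"
      unfolding signature_def interleave_def pos[OF D] i using content(2)[OF D]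
      unfolding le_one_cases by auto
    then show ?thesis using coordinate_node(3)[OF la adm] D by (simp add: D_def)
  qed
  have supp: "{p. signature d e s m i la p \<noteq> 0} \<subseteq> position d s m ` W"
  proof
    fix p assume "p \<in> {p. signature d e s m i la p \<noteq> 0}"
    then have nz: "signature d e s m i la p \<noteq> 0" by simp
    define c :: nat where "c = (if even p = d then 0 else 1)"
    have i: "(int (p div 2) - int m) mod e = i" and l: "letter (symbol_row s m la c) (p div 2) \<noteq> 0"
      using nz by (auto simp: signature_def interleave_def c_def split: if_splits)
    obtain g where g: "addable la g \<or> removable la g" "coordinates s m g = (p div 2, c)"
      by (rule node_of_letter[OF la adm _ l]) (simp_all add: c_def)
    then have "position d s m g = p"
      by (cases d; cases "even p") (auto simp: position_def coordinates_def c_def)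
    moreover have "g \<in> W" using g i W by (auto simp: D_def coordinates_def)
    ultimately show "p \<in> position d s m ` W" by blast
  qed
  have "finite {p. signature d e s m i la p \<noteq> 0}"
  proof (rule finite_subset)
    let ?F = "\<Union>c\<in>{0,1}. {x. letter (symbol_row s m la c) x \<noteq> 0}"
    show "finite ((\<lambda>x. 2 * x) ` ?F \<union> (\<lambda>x. Suc (2 * x)) ` ?F)"
      by (auto simp: symbol_row_def intro!: letter_finite)
    show "{p. signature d e s m i la p \<noteq> 0} \<subseteq> (\<lambda>x. 2 * x) ` ?F \<union> (\<lambda>x. Suc (2 * x)) ` ?F"
    proof
      fix p assume "p \<in> {p. signature d e s m i la p \<noteq> 0}"
      then have "p div 2 \<in> ?F"
        by (auto simp: signature_def interleave_def split: if_splits)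
      moreover have "p = 2 * (p div 2) \<or> p = Suc (2 * (p div 2))" by presburger
      ultimately show "p \<in> (\<lambda>x. 2 * x) ` ?F \<union> (\<lambda>x. Suc (2 * x)) ` ?F" by blast
    qed
  qed
  then show ?thesis unfolding encodes_signature_def using inj less sign supp unfolding W_def by blast
qed

section \<open>Crystal edges\<close>

lemma adds_node_addable: "adds_node la g mu \<Longrightarrow> addable la g"
  and adds_node_removable: "adds_node la g mu \<Longrightarrow> removable mu g"
  unfolding addable_def removable_def by blast+

lemma adds_node_length: "adds_node la g mu \<Longrightarrow> c \<le> 1 \<Longrightarrow> length (pick la c) \<le> length (pick mu c)"
proof -
  assume add: "adds_node la g mu" and c: "c \<le> 1"
  obtain a b c' where "g = (a, b, c')" by (cases g)
  with add have R: "is_bipartition la" "is_bipartition mu" "c' \<le> 1"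
    "part (pick mu c') = (part (pick la c'))(a := Suc (part (pick la c') a))"
    "pick mu (1 - c') = pick la (1 - c')" by (auto simp: adds_node_iff)
  have "c = c' \<or> c = 1 - c'" using c R(3) by auto
  then have le: "part (pick la c) k \<le> part (pick mu c) k" for k using R by auto
  show ?thesis
  proof (cases "pick la c = []")
    case False
    then have "0 < part (pick la c) (length (pick la c))"
      using part_pos_iff[OF bipartition_pick[OF R(1)]] by (simp add: Suc_leI)
    then have "0 < part (pick mu c) (length (pick la c))" using le[of "length (pick la c)"] by simp
    then show ?thesis using part_pos_iff[OF bipartition_pick[OF R(2)]] by blast
  qed simp
qed

lemma adds_node_admissible: "adds_node la g mu \<Longrightarrow> symbol_admissible s m mu \<Longrightarrow> symbol_admissible s m la"
  unfolding symbol_admissible_iff using adds_node_length le_less_trans by blast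

lemma adds_node_rows:
  assumes add: "adds_node la g mu" and adm: "symbol_admissible s m la"
  obtains y where "coordinate s m g = Suc y" "node_component g \<le> 1"
    "symbol_row s m mu (node_component g) = slide y (symbol_row s m la (node_component g))"
    "symbol_row s m mu (1 - node_component g) = symbol_row s m la (1 - node_component g)"
    "letter (symbol_row s m la (node_component g)) (Suc y) = - 1"
proof -
  obtain a b c where g: "g = (a, b, c)" by (cases g)
  let ?p = "pick la c" and ?M = "m + pick s c"
  have R: "is_bipartition la" "is_bipartition mu" "c \<le> 1" "1 \<le> a" "b = Suc (part ?p a)"
    "part (pick mu c) = (part ?p)(a := Suc (part ?p a))"
    "pick mu (1 - c) = pick la (1 - c)" using add unfolding g by (auto simp: adds_node_iff)
  have ad: "addable la g" using add by (rule adds_node_addable)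
  have len: "length ?p < ?M" using adm R(3) symbol_admissible_iff by blast
  have "part ?p (a - 1) \<noteq> 0 \<or> a = 1" using ad unfolding g addable_iff[OF R(1)] by auto
  then have aM: "a \<le> ?M" using part_beyond[of ?p "a - 1"] len R(4) by fastforce
  have x: "coordinate s m g = Suc (beta ?M ?p a)" using aM by (auto simp: g R(5) beta_def)
  have l: "letter (symbol_row s m la (node_component g)) (coordinate s m g) = - 1"
    using coordinate_node(3)[OF R(1) adm] ad not_addable_removable[OF ad] by (auto simp: node_sign_def)
  show thesis
    using that[OF x] l[unfolded x] R(3,7) beta_set_add[OF bipartition_pick[OF R(1)] R(4) aM R(6)]
    by (simp add: g symbol_row_eq x del: letter.simps)
qed

lemma letter_slide_other:
  assumes "x \<noteq> y" "x \<noteq> Suc y" "x \<noteq> Suc (Suc y)"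
  shows "letter (slide y X) x = letter X x"
  using assms by (cases x) (auto simp: slide_def)

text \<open>Since \<open>e\<close> is at least 2, adding an \<open>i\<close>-node changes no other letter at a coordinate of residue
  \<open>i\<close>: only the letters next to it change.\<close>

lemma congruent_not_near:
  assumes "1 < (e :: int)" "(int x - int m) mod e = (int (Suc y) - int m) mod e" "x \<noteq> Suc y"
  shows "x \<noteq> y" "x \<noteq> Suc (Suc y)"
proof -
  have "e dvd (int x - int m) - (int (Suc y) - int m)" using assms(2) unfolding mod_eq_dvd_iff .
  then have "e dvd int x - int (Suc y)" by (simp only: diff_diff_eq2 diff_add_cancel)
  then show "x \<noteq> y" "x \<noteq> Suc (Suc y)" using dvd_imp_le_int[of "int x - int (Suc y)" e] assms(1,3) by auto
qed

lemma residue_coordinate: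
  assumes "is_bipartition la" "symbol_admissible s m la" "addable la g \<or> removable la g"
  shows "node_residue e (charge d e s) g = (int (coordinate s m g) - int m) mod e"
proof -
  have "node_content (charge d e s) g = int (coordinate s m g) - int m +
      (if d \<and> node_component g = 1 then e else 0)"
    using coordinate_node(1,2)[OF assms]
    by (cases g) (auto simp: charge_def pick_def le_one_cases)
  then show ?thesis by (simp add: node_residue_def)
qed

lemma position_decode:
  "c \<le> 1 \<Longrightarrow> p = 2 * x + (if d then c else 1 - c) \<longleftrightarrow>
     p div 2 = x \<and> (if even p = d then 0 else 1) = (c :: nat)"
  unfolding le_one_cases by (cases d; elim disjE; simp; presburger)

text \<open>Good nodes are defined on the larger bipartition. Their removal changes exactly one sign of
  residue \<open>i\<close>, so the condition can be read off from the smaller bipartition.\<close>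

lemma crystal_edge_iff:
  assumes e: "1 < e" and adm: "symbol_admissible s m mu"
  shows "crystal_edge e (charge d e s) i la mu \<longleftrightarrow>
    (\<exists>g. adds_node la g mu \<and> node_residue e (charge d e s) g = i \<and>
      first_minimum (signature d e s m i la) (position d s m g))"
proof -
  have "good_node e (charge d e s) mu i g \<longleftrightarrow> node_residue e (charge d e s) g = i \<and>
      first_minimum (signature d e s m i la) (position d s m g)" if add: "adds_node la g mu" for g
  proof (cases "node_residue e (charge d e s) g = i")
    case True
    have la: "is_bipartition la" and mu: "is_bipartition mu" using add by (auto simp: adds_node_def)
    have adm': "symbol_admissible s m la" using adds_node_admissible[OF add adm] .
    have rem: "removable mu g" and ad: "addable la g" using add by (auto intro: adds_node_addable adds_node_removable)
    obtain y where y: "coordinate s m g = Suc y" "node_component g \<le> 1"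
      "symbol_row s m mu (node_component g) = slide y (symbol_row s m la (node_component g))"
      "symbol_row s m mu (1 - node_component g) = symbol_row s m la (1 - node_component g)"
      "letter (symbol_row s m la (node_component g)) (Suc y) = - 1"
      using adds_node_rows[OF add adm'] .
    have i: "(int (Suc y) - int m) mod e = i"
      using residue_coordinate[OF la adm', of g] ad y(1) True by simp
    have "(signature d e s m i mu)(position d s m g := - 1) = signature d e s m i la"
    proof
      fix p :: nat
      let ?c = "if even p = d then 0 else 1 :: nat"
      have sig: "signature d e s m i nu p = (if (int (p div 2) - int m) mod e = i
          then letter (symbol_row s m nu ?c) (p div 2) else 0)" for nu
        by (auto simp: signature_def interleave_def)
      have pos: "p = position d s m g \<longleftrightarrow> p div 2 = Suc y \<and> ?c = node_component g"
        unfolding position_def y(1) using position_decode[OF y(2)] by blast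
      show "((signature d e s m i mu)(position d s m g := - 1)) p = signature d e s m i la p"
      proof (cases "p = position d s m g")
        case True
        then have pc: "p div 2 = Suc y" "?c = node_component g" using pos by blast+
        have "signature d e s m i la p = - 1"
          unfolding sig pc by (simp only: y(5) i if_True simp_thms)
        then show ?thesis using True by simp
      next
        case False
        have "letter (symbol_row s m mu ?c) (p div 2) = letter (symbol_row s m la ?c) (p div 2)"
          if "(int (p div 2) - int m) mod e = i"
        proof (cases "?c = node_component g")
          case True
          then have ne: "p div 2 \<noteq> Suc y" using False pos by blast
          then show ?thesis
            unfolding True y(3) using congruent_not_near[OF e, of "p div 2" m y] that i
            by (intro letter_slide_other) simp_all
        next
          case False
          then have "?c = 1 - node_component g" using y(2) by auto
          then show ?thesis using y(4) by simp
        qed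
        then show ?thesis using False by (simp add: sig)
      qed
    qed
    then show ?thesis
      using good_node_iff[OF encodes_signature[of e mu s m d i], of g] e mu adm rem True by auto
  next
    case False
    have "is_bipartition mu" using add by (auto simp: adds_node_def)
    then show ?thesis
      using good_node_iff[OF encodes_signature[of e mu s m d i], of g] e adm False by auto
  qed
  then show ?thesis unfolding crystal_edge_def by blast
qed

lemma admissible_exists: "\<exists>m. symbol_admissible s m la \<and> symbol_admissible s m mu"
  unfolding symbol_admissible_iff le_one_cases
  by (rule exI[of _ "Suc (length (fst la) + length (snd la) + length (fst mu) + length (snd mu))"])
    (auto simp: pick_def)

lemma signature_added_node:
  assumes "0 < e" "adds_node la g mu" "symbol_admissible s m la" "node_residue e (charge d e s) g = i"
  shows "signature d e s m i la (position d s m g) = - 1" "g \<in> signature_nodes e (charge d e s) la i"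
proof -
  have la: "is_bipartition la" using assms(2) by (simp add: adds_node_def)
  have ad: "addable la g" using assms(2) by (rule adds_node_addable)
  then show g: "g \<in> signature_nodes e (charge d e s) la i" using assms(4) by (simp add: signature_nodes_def)
  then show "signature d e s m i la (position d s m g) = - 1"
    using encodes_signature[OF assms(1) la assms(3), of d i] not_addable_removable[OF ad] ad
    unfolding encodes_signature_def by (simp add: node_sign_def)
qed

lemma crystal_edge_unique:
  assumes e: "1 < e" and "crystal_edge e (charge d e s) i la mu" "crystal_edge e (charge d e s) i la mu'"
  shows "mu = mu'"
proof -
  \<comment> \<open>Edges are independent of \<open>m\<close>, so any \<open>m\<close> admissible for both targets will do.\<close>
  obtain m where m: "symbol_admissible s m mu" "symbol_admissible s m mu'" using admissible_exists by blast
  obtain g g' where g: "adds_node la g mu" "node_residue e (charge d e s) g = i"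
      "first_minimum (signature d e s m i la) (position d s m g)"
    and g': "adds_node la g' mu'" "node_residue e (charge d e s) g' = i"
      "first_minimum (signature d e s m i la) (position d s m g')"
    using assms(2,3) unfolding crystal_edge_iff[OF e m(1)] crystal_edge_iff[OF e m(2)] by blast
  have e0: "0 < e" using e by simp
  have adm: "symbol_admissible s m la" using adds_node_admissible[OF g(1) m(1)] .
  note sg = signature_added_node[OF e0 g(1) adm g(2)] signature_added_node[OF e0 g'(1) adm g'(2)]
  have "position d s m g = position d s m g'"
    using first_minimum_unique[OF g(3) sg(1) g'(3) sg(3)] .
  moreover have "inj_on (position d s m) (signature_nodes e (charge d e s) la i)"
    using encodes_signature[OF e0 _ adm, of d i] g(1) by (auto simp: encodes_signature_def adds_node_def)
  ultimately have "g = g'" using sg by (meson inj_onD)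
  then show ?thesis using adds_node_unique g(1) g'(1) by blast
qed

text \<open>Suppose \<open>E\<close> and \<open>F\<close> have the same total on every block \<open>{2k, 2k + 1}\<close>. Then their partial sums
  agree between the blocks. Inside a block a partial sum can be smaller than at both ends only for
  the signs \<open>(-1, 1)\<close>, which occur for \<open>E\<close> and \<open>F\<close> simultaneously. So the minimum is first attained
  in the same block, and the position within the block is then determined by its two signs.\<close>

lemma first_minimum_swap:
  fixes E F :: "nat \<Rightarrow> int"
  assumes rE: "\<And>p. - 1 \<le> E p \<and> E p \<le> 1" and rF: "\<And>p. - 1 \<le> F p \<and> F p \<le> 1"
    and total: "\<And>k. E (2 * k) + E (Suc (2 * k)) = F (2 * k) + F (Suc (2 * k))"
    and dip: "\<And>k. E (2 * k) = - 1 \<and> E (Suc (2 * k)) = 1 \<longleftrightarrow> F (2 * k) = - 1 \<and> F (Suc (2 * k)) = 1"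
    and fm: "first_minimum E P" "E P = - 1"
  shows "P = 2 * x \<Longrightarrow> E (Suc (2 * x)) \<noteq> - 1"
    and "P = Suc (2 * x) \<Longrightarrow> E (2 * x) \<noteq> 1"
    and "P = 2 * x \<or> P = Suc (2 * x) \<Longrightarrow>
      F (2 * x) = - 1 \<and> F (Suc (2 * x)) \<noteq> - 1 \<and> first_minimum F (2 * x) \<or>
      F (Suc (2 * x)) = - 1 \<and> F (2 * x) \<noteq> 1 \<and> first_minimum F (Suc (2 * x))"
proof -
  define S where "S q = sum E {..<q}" for q
  define R where "R q = sum F {..<q}" for q
  define \<mu> where "\<mu> = S P - 1"
  have S: "S (Suc q) = S q + E q" for q by (simp add: S_def)
  have R: "R (Suc q) = R q + F q" for q by (simp add: R_def)
  have low: "\<mu> + 1 \<le> S q" if "q \<le> P" for q using fm(1) that by (simp add: first_minimum_def S_def \<mu>_def)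
  have low': "\<mu> \<le> S q" for q using fm(1) by (cases "q \<le> P") (auto simp: first_minimum_def S_def \<mu>_def)
  have SP: "S P = \<mu> + 1" "S (Suc P) = \<mu>" using fm(2) by (simp_all add: S \<mu>_def)
  show 1: "E (Suc (2 * x)) \<noteq> - 1" if "P = 2 * x"
    using low'[of "Suc (Suc (2 * x))"] SP S that by auto
  show 2: "E (2 * x) \<noteq> 1" if "P = Suc (2 * x)"
    using low[of "2 * x"] SP S[of "2 * x"] that by auto
  have even: "R (2 * k) = S (2 * k)" for k
  proof (induction k)
    case (Suc k)
    then show ?case using total[of k] by (simp add: S R)
  qed (simp add: S_def R_def)
  \<comment> \<open>Any lower bound for \<open>S\<close> on a block is a lower bound for \<open>R\<close> in its middle.\<close>
  have odd: "b \<le> R (Suc (2 * k))" if "b \<le> S (2 * k)" "b \<le> S (Suc (2 * k))" "b \<le> S (Suc (Suc (2 * k)))" for b k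
  proof -
    have "R (Suc (Suc (2 * k))) = S (Suc (Suc (2 * k)))" using even[of "Suc k"] by simp
    then show ?thesis
      using that R[of "2 * k"] R[of "Suc (2 * k)"] even[of k] S[of "2 * k"] dip[of k] rF[of "2 * k"] rF[of "Suc (2 * k)"]
      by (smt (verit))
  qed
  have parity: "\<exists>k. q = 2 * k \<or> q = Suc (2 * k)" for q :: nat by presburger
  have lowR': "\<mu> \<le> R q" for q
    using parity[of q] odd[OF low' low' low'] even low' by metis
  have lowR: "\<mu> + 1 \<le> R q" if "q \<le> 2 * x" "2 * x \<le> P" for q
  proof -
    obtain k where "q = 2 * k \<or> q = Suc (2 * k)" using parity by blast
    then show ?thesis
    proof
      assume "q = 2 * k"
      then show ?thesis using low[of q] even[of k] that by simp
    next
      assume q: "q = Suc (2 * k)"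
      then have "Suc (Suc (2 * k)) \<le> P" using that by presburger
      then show ?thesis unfolding q by (intro odd low) simp_all
    qed
  qed
  have fmI: "first_minimum F Q" if "R Q = \<mu> + 1" "\<And>q. q \<le> Q \<Longrightarrow> \<mu> + 1 \<le> R q" for Q
    using that lowR' unfolding first_minimum_def R_def by simp
  show "F (2 * x) = - 1 \<and> F (Suc (2 * x)) \<noteq> - 1 \<and> first_minimum F (2 * x) \<or>
      F (Suc (2 * x)) = - 1 \<and> F (2 * x) \<noteq> 1 \<and> first_minimum F (Suc (2 * x))"
    if P: "P = 2 * x \<or> P = Suc (2 * x)"
  proof -
    have xP: "2 * x \<le> P" using P by auto
    have R2: "R (Suc (2 * x)) = S (2 * x) + F (2 * x)" by (simp add: R even)
    have "F (2 * x) = - 1 \<and> F (Suc (2 * x)) \<noteq> - 1 \<and> R (2 * x) = \<mu> + 1 \<or>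
      F (Suc (2 * x)) = - 1 \<and> F (2 * x) \<noteq> 1 \<and> R (Suc (2 * x)) = \<mu> + 1"
      using P
    proof
      assume P: "P = 2 * x"
      then show ?thesis using 1 SP(1) fm(2) total[of x] dip[of x] rF[of "2 * x"] rF[of "Suc (2 * x)"]
          rE[of "Suc (2 * x)"] R2 even[of x] by (smt (verit))
    next
      assume P: "P = Suc (2 * x)"
      then show ?thesis using 2 SP(1) S[of "2 * x"] fm(2) total[of x] dip[of x] rF[of "2 * x"] rF[of "Suc (2 * x)"]
          rE[of "2 * x"] R2 even[of x] by (smt (verit))
    qed
    then show ?thesis
    proof (elim disjE conjE)
      assume "F (2 * x) = - 1" "F (Suc (2 * x)) \<noteq> - 1" "R (2 * x) = \<mu> + 1"
      then show ?thesis using fmI[of "2 * x"] lowR xP by auto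
    next
      assume *: "F (Suc (2 * x)) = - 1" "F (2 * x) \<noteq> 1" "R (Suc (2 * x)) = \<mu> + 1"
      have "\<mu> + 1 \<le> R q" if "q \<le> Suc (2 * x)" for q
        using lowR[of q] xP * that by (cases "q = Suc (2 * x)") auto
      then show ?thesis using fmI[of "Suc (2 * x)"] * by auto
    qed
  qed
qed

section \<open>The exchange map commutes with the crystal operators\<close>

text \<open>The ballot condition is part of the relation because the construction of \<open>\<theta>\<close> depends on it; it
  has to be propagated along the crystal together with the description of the image.\<close>

definition exchange_related :: "nat \<times> nat \<Rightarrow> nat \<Rightarrow> bipartition \<Rightarrow> bipartition \<Rightarrow> bool" where
  "exchange_related s m la mu \<longleftrightarrow> is_bipartition la \<and> is_bipartition mu \<and>
     symbol_admissible s m la \<and> symbol_admissible s m mu \<and>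
     ballot (symbol_row s m la 1) (symbol_row s m la 0) \<and>
     symbol_row s m mu 0 = matched (symbol_row s m la 1) (symbol_row s m la 0) \<and>
     symbol_row s m mu 1 = top_row (symbol_row s m la 1) (symbol_row s m la 0)"

lemma zero_in_symbol_rows:
  assumes "is_bipartition la"
  shows "symbol_admissible s m la \<longleftrightarrow> 0 \<in> symbol_row s m la 0 \<and> 0 \<in> symbol_row s m la 1"
  using zero_in_beta_set[OF bipartition_pick[OF assms]]
  unfolding symbol_admissible_iff le_one_cases symbol_row_eq by blast

lemma add_node_at_letter:
  assumes mu: "is_bipartition mu" and adm: "symbol_admissible s m mu" and c: "c \<le> 1"
    and l: "letter (symbol_row s m mu c) (Suc y) = - 1"
  obtains g nu where "adds_node mu g nu" "coordinate s m g = Suc y" "node_component g = c"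
    "symbol_row s m nu c = slide y (symbol_row s m mu c)"
    "symbol_row s m nu (1 - c) = symbol_row s m mu (1 - c)"
proof -
  obtain g where g: "addable mu g \<or> removable mu g" "coordinates s m g = (Suc y, c)"
    using node_of_letter[OF mu adm c, of "Suc y"] l by auto
  then have gc: "coordinate s m g = Suc y" "node_component g = c" by (auto simp: coordinates_def)
  have "node_sign mu g = - 1" using coordinate_node(3)[OF mu adm g(1)] gc l by simp
  then obtain nu where nu: "adds_node mu g nu"
    using g(1) by (auto simp: node_sign_def addable_def split: if_splits)
  obtain z where "coordinate s m g = Suc z"
    "symbol_row s m nu (node_component g) = slide z (symbol_row s m mu (node_component g))"
    "symbol_row s m nu (1 - node_component g) = symbol_row s m mu (1 - node_component g)"
    using adds_node_rows[OF nu adm] .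
  then show thesis using that[OF nu gc] gc by simp
qed

text \<open>The exchange map commutes with the crystal operators. The operator acts at one coordinate \<open>Suc y\<close>,
  the same for both charges by the swap of first minima, and there the claim is the local one.\<close>

lemma exchange_related_step:
  assumes e: "1 < e" and rel: "exchange_related s m la' mu'"
    and edge: "crystal_edge e (charge False e s) i la' la" and adm: "symbol_admissible s m la"
  obtains mu where "crystal_edge e (charge True e s) i mu' mu" "exchange_related s m la mu"
proof -
  define T B T1 B1 where "T = symbol_row s m la' 1" and "B = symbol_row s m la' 0"
    and "T1 = symbol_row s m la 1" and "B1 = symbol_row s m la 0"
  have mu': "is_bipartition mu'" "symbol_admissible s m mu'"
    and rows': "symbol_row s m mu' 0 = matched T B" "symbol_row s m mu' 1 = top_row T B"
    and la': "is_bipartition la'" "symbol_admissible s m la'" and bal: "ballot T B"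
    using rel unfolding exchange_related_def T_def B_def by auto
  obtain g where g: "adds_node la' g la" "node_residue e (charge False e s) g = i"
    "first_minimum (signature False e s m i la') (position False s m g)"
    using edge unfolding crystal_edge_iff[OF e adm] by blast
  have la: "is_bipartition la" using g(1) by (simp add: adds_node_def)
  have e0: "0 < e" using e by simp
  obtain y where y: "coordinate s m g = Suc y" "node_component g \<le> 1"
      "symbol_row s m la (node_component g) = slide y (symbol_row s m la' (node_component g))"
      "symbol_row s m la (1 - node_component g) = symbol_row s m la' (1 - node_component g)"
      "letter (symbol_row s m la' (node_component g)) (Suc y) = - 1"
    using adds_node_rows[OF g(1) la'(2)] .
  have "addable la' g" using g(1) by (rule adds_node_addable)
  then have i: "(int (Suc y) - int m) mod e = i"
    using residue_coordinate[OF la', of g e False] y(1) g(2) by simp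
  define E F P where "E = interleave e m i T B" and "F = interleave e m i (matched T B) (top_row T B)"
    and "P = position False s m g"
  have sigs: "signature False e s m i la' = E" "signature True e s m i mu' = F"
    by (simp_all add: signature_def E_def F_def T_def B_def rows' del: One_nat_def)
  have fm: "first_minimum E P" "E P = - 1"
    using g(3) signature_added_node(1)[OF e0 g(1) la'(2) g(2)] by (simp_all add: sigs P_def)
  have ev: "interleave e m i X Y (2 * k) = (if (int k - int m) mod e = i then letter X k else 0)"
     "interleave e m i X Y (Suc (2 * k)) = (if (int k - int m) mod e = i then letter Y k else 0)" for X Y k
    by (simp_all add: interleave_def)
  have rng: "- 1 \<le> interleave e m i X Y p \<and> interleave e m i X Y p \<le> 1" for X Y p
    using letter_range[of "if even p then X else Y" "p div 2"] by (auto simp: interleave_def)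
  have total: "E (2 * k) + E (Suc (2 * k)) = F (2 * k) + F (Suc (2 * k))" for k
    using letter_exchange(1)[of T B k] by (simp add: E_def F_def ev)
  have dip: "E (2 * k) = - 1 \<and> E (Suc (2 * k)) = 1 \<longleftrightarrow> F (2 * k) = - 1 \<and> F (Suc (2 * k)) = 1" for k
    using letter_exchange(2)[of T k B] by (simp add: E_def F_def ev)
  have at: "E (2 * Suc y) = letter T (Suc y)" "E (Suc (2 * Suc y)) = letter B (Suc y)"
    "F (2 * Suc y) = letter (matched T B) (Suc y)" "F (Suc (2 * Suc y)) = letter (top_row T B) (Suc y)"
    using i by (simp_all only: E_def F_def ev simp_thms if_True)
  have P: "P = 2 * Suc y + (1 - node_component g)" by (simp add: P_def position_def y(1))
  note swap = first_minimum_swap[OF rng[of T B, folded E_def] rng[of "matched T B" "top_row T B", folded F_def]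
      total dip fm, of "Suc y"]
  have move: "letter T (Suc y) = - 1 \<and> letter B (Suc y) \<noteq> - 1 \<and> T1 = slide y T \<and> B1 = B \<or>
     letter B (Suc y) = - 1 \<and> letter T (Suc y) \<noteq> 1 \<and> T1 = T \<and> B1 = slide y B"
  proof (cases "node_component g = 1")
    case True
    then show ?thesis using swap(1) y(3-5) P unfolding at T_def B_def T1_def B1_def by simp
  next
    case False
    then have "node_component g = 0" using y(2) by simp
    then show ?thesis using swap(2) y(3-5) P unfolding at T_def B_def T1_def B1_def by simp
  qed
  have bal1: "ballot T1 B1"
    using move ballot_slide[OF bal, of y] letter_Suc_iff(1)[of B y] by auto
  \<comment> \<open>0 lies in both rows, hence is matched with itself and stays in both rows.\<close>
  have zero: "0 \<in> matched T1 B1" "0 \<in> top_row T1 B1"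
    using adm zero_in_symbol_rows[OF la] Int_subset_matched[of T1 B1] unfolding T1_def B1_def by auto
  note result = that
  have finish: thesis if c: "c \<le> 1" and l: "letter (symbol_row s m mu' c) (Suc y) = - 1"
    and fF: "first_minimum F (2 * Suc y + c)"
    and target: "\<And>nu. symbol_row s m nu c = slide y (symbol_row s m mu' c) \<Longrightarrow>
      symbol_row s m nu (1 - c) = symbol_row s m mu' (1 - c) \<Longrightarrow>
      symbol_row s m nu 0 = matched T1 B1 \<and> symbol_row s m nu 1 = top_row T1 B1" for c
  proof -
    obtain h nu where nu: "adds_node mu' h nu" "coordinate s m h = Suc y" "node_component h = c"
      "symbol_row s m nu c = slide y (symbol_row s m mu' c)"
      "symbol_row s m nu (1 - c) = symbol_row s m mu' (1 - c)"
      using add_node_at_letter[OF mu' c l] .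
    have rows: "symbol_row s m nu 0 = matched T1 B1" "symbol_row s m nu 1 = top_row T1 B1"
      using target[OF nu(4,5)] by auto
    have bip: "is_bipartition nu" using nu(1) by (simp add: adds_node_def)
    have adm_nu: "symbol_admissible s m nu" using zero_in_symbol_rows[OF bip] rows zero by blast
    have "addable mu' h" using nu(1) by (rule adds_node_addable)
    then have "node_residue e (charge True e s) h = i"
      using residue_coordinate[OF mu', of h e True] nu(2) i by simp
    moreover have "position True s m h = 2 * Suc y + c" by (simp add: position_def nu(2,3))
    ultimately have "crystal_edge e (charge True e s) i mu' nu"
      unfolding crystal_edge_iff[OF e adm_nu] using nu(1) fF sigs by metis
    moreover have "exchange_related s m la nu"
      unfolding exchange_related_def using la bip adm adm_nu bal1 rows unfolding T1_def B1_def by blast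
    ultimately show thesis by (rule result)
  qed
  have "P = 2 * Suc y \<or> P = Suc (2 * Suc y)" using P y(2) by auto
  from swap(3)[OF this, unfolded at] show thesis
  proof (elim disjE conjE)
    assume l: "letter (matched T B) (Suc y) = - 1" "letter (top_row T B) (Suc y) \<noteq> - 1" "first_minimum F (2 * Suc y)"
    have ex: "matched T1 B1 = slide y (matched T B)" "top_row T1 B1 = top_row T B"
      using exchange_slide(1)[OF move] l(1,2) by blast+
    show thesis
    proof (rule finish[of 0])
      show "letter (symbol_row s m mu' 0) (Suc y) = - 1" using l(1) unfolding rows' .
      show "first_minimum F (2 * Suc y + 0)" using l(3) unfolding add_0_right .
      show "symbol_row s m nu 0 = matched T1 B1 \<and> symbol_row s m nu 1 = top_row T1 B1"
        if "symbol_row s m nu 0 = slide y (symbol_row s m mu' 0)"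
          "symbol_row s m nu (1 - 0) = symbol_row s m mu' (1 - 0)" for nu
        using that ex unfolding diff_zero rows' by (blast intro: trans sym)
    qed simp
  next
    assume l: "letter (top_row T B) (Suc y) = - 1" "letter (matched T B) (Suc y) \<noteq> 1" "first_minimum F (Suc (2 * Suc y))"
    have ex: "matched T1 B1 = matched T B" "top_row T1 B1 = slide y (top_row T B)"
      using exchange_slide(2)[OF move] l(1,2) by blast+
    show thesis
    proof (rule finish[of 1])
      show "letter (symbol_row s m mu' 1) (Suc y) = - 1" using l(1) unfolding rows' .
      show "first_minimum F (2 * Suc y + 1)" using l(3) unfolding Suc_eq_plus1 .
      show "symbol_row s m nu 0 = matched T1 B1 \<and> symbol_row s m nu 1 = top_row T1 B1"
        if "symbol_row s m nu 1 = slide y (symbol_row s m mu' 1)"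
          "symbol_row s m nu (1 - 1) = symbol_row s m mu' (1 - 1)" for nu
        using that ex unfolding diff_self_eq_0 rows' by (blast intro: trans sym)
    qed simp
  qed
qed

text \<open>The hypothesis \<open>s\<^sub>0 \<le> s\<^sub>1\<close> is needed here: the bottom row of the empty symbol is an initial segment of
  the top row, every bottom entry is its own partner, and the exchange map does nothing.\<close>

lemma exchange_related_empty:
  assumes "fst s \<le> snd s" "0 < m + fst s"
  shows "exchange_related s m ([], []) ([], [])"
proof -
  have beta: "beta_set M [] = {..<M}" for M
  proof -
    have "x \<in> beta_set M []" if "x < M" for x
      unfolding beta_set_def using that by (intro image_eqI[of _ _ "M - x"]) (auto simp: beta_def part_def)
    then show ?thesis by (auto simp: beta_set_def beta_def part_def)
  qed
  define p q where "p = m + snd s" and "q = m + fst s"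
  have rows: "symbol_row s m ([], []) 0 = {..<q}" "symbol_row s m ([], []) 1 = {..<p}"
    by (simp_all add: symbol_row_eq pick_def beta p_def q_def)
  have qp: "q \<le> p" using assms by (simp add: p_def q_def)
  have ex: "excess {..<p} {..<q} v = int (min v p) - int (min v q)" for v
    by (induction v) auto
  have M: "matched {..<p} {..<q} = {..<q}"
  proof -
    have "t \<in> matched {..<p} {..<q}" if "t < q" for t
      unfolding matched_def using that qp by (auto simp: ex intro!: exI[of _ "Suc t"])
    moreover have "t < q" if t: "t \<in> matched {..<p} {..<q}" for t
    proof (rule ccontr)
      assume "\<not> t < q"
      moreover obtain w where "t < p" "t < w" "excess {..<p} {..<q} w \<le> excess {..<p} {..<q} t"
        using t by (auto simp: matched_def)
      ultimately show False by (auto simp: ex min_def split: if_splits)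
    qed
    ultimately show ?thesis by blast
  qed
  have "ballot {..<p} {..<q}" using qp by (auto simp: ballot_def ex)
  moreover have "symbol_admissible s m ([], [])"
    using assms unfolding symbol_admissible_iff le_one_cases by (auto simp: pick_def)
  moreover have "is_bipartition ([], [])" by (simp add: is_bipartition_def is_partition_def)
  moreover have "{..<p} = {..<p} - {..<q} \<union> {..<q}" using qp by auto
  ultimately show ?thesis unfolding exchange_related_def rows M by (intro conjI refl)
qed

lemma Psi_graph_exists:
  assumes "1 < e" "fst s \<le> snd s" "la \<in> uglov_bipartitions e (charge False e s) n" "symbol_admissible s m la"
  shows "\<exists>mu. Psi_graph e (charge False e s) (charge True e s) la mu \<and> exchange_related s m la mu"
  using assms(3,4)
proof (induction n arbitrary: la)
  case 0
  then have "la = ([], [])" by simp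
  moreover from this 0 have "0 < m + fst s" by (auto simp: symbol_admissible_iff pick_def dest: spec[of _ 0])
  ultimately show ?case using exchange_related_empty[OF assms(2), of m] Psi_graph.empty[of e "charge False e s" "charge True e s"] by auto
next
  case (Suc n)
  then obtain i la' where la': "la' \<in> uglov_bipartitions e (charge False e s) n"
    and edge: "crystal_edge e (charge False e s) i la' la" by auto
  have "symbol_admissible s m la'"
    using edge Suc.prems(2) adds_node_admissible unfolding crystal_edge_def by blast
  then obtain mu' where mu': "Psi_graph e (charge False e s) (charge True e s) la' mu'"
    "exchange_related s m la' mu'" using Suc.IH[OF la'] by blast
  obtain mu where "crystal_edge e (charge True e s) i mu' mu" "exchange_related s m la mu"
    using exchange_related_step[OF assms(1) mu'(2) edge Suc.prems(2)] .
  then show ?case using Psi_graph.step[OF mu'(1) edge] by blast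
qed

text \<open>Along any path the image is forced step by step, since crystal operators are single-valued. In
  particular the result does not depend on the chosen path.\<close>

lemma Psi_graph_exchange_related:
  assumes "1 < e" "fst s \<le> snd s" "Psi_graph e (charge False e s) (charge True e s) la mu"
    "symbol_admissible s m la"
  shows "exchange_related s m la mu"
  using assms(3,4)
proof induction
  case empty
  then have "0 < m + fst s" by (auto simp: symbol_admissible_iff pick_def dest: spec[of _ 0])
  then show ?case by (rule exchange_related_empty[OF assms(2)])
next
  case (step la' mu' i la mu)
  have "symbol_admissible s m la'"
    using step.hyps(2) step.prems adds_node_admissible unfolding crystal_edge_def by blast
  then have "exchange_related s m la' mu'" by (rule step.IH)
  then obtain nu where "crystal_edge e (charge True e s) i mu' nu" "exchange_related s m la nu"
    using exchange_related_step[OF assms(1) _ step.hyps(2) step.prems] by blast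
  then show ?case using crystal_edge_unique[OF assms(1) step.hyps(3)] by blast
qed

lemma Psi_graph_rank: "Psi_graph e s s' la mu \<Longrightarrow> bip_rank mu = bip_rank la"
proof (induction rule: Psi_graph.induct)
  case (step la' mu' i la mu)
  then show ?case using bip_rank_add unfolding crystal_edge_def by metis
qed simp

lemma bip_symbol_inj:
  assumes "is_bipartition mu" "is_bipartition nu" "symbol_admissible s m mu" "symbol_admissible s m nu"
    "bip_symbol s m mu = bip_symbol s m nu"
  shows "mu = nu"
proof -
  have "pick mu c = pick nu c" if "c \<le> 1" for c
  proof (rule beta_set_inj[of _ "m + pick s c"])
    show "beta_set (m + pick s c) (pick mu c) = beta_set (m + pick s c) (pick nu c)"
      using assms(5) that unfolding bip_symbol_def le_one_cases symbol_row_eq by auto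
  qed (use assms(1-4) that in \<open>auto simp: symbol_admissible_iff intro: bipartition_pick\<close>)
  then show ?thesis by (intro bipartition_eqI[of mu 0]) auto
qed

lemma symbol_Upsilon_eq:
  assumes "exchange_related s m la mu" "bip_rank mu = bip_rank la"
  shows "symbol_Upsilon s m la = mu"
  unfolding symbol_Upsilon_def
proof (rule the_equality)
  have "finite (symbol_row s m la 0)" by (simp add: symbol_row_def)
  then have ex: "bip_symbol s m mu = exchange_pairs (bip_symbol s m la)"
    using assms(1) exchange_pairs_eq unfolding exchange_related_def bip_symbol_def by simp
  show "mu \<in> bipartitions (bip_rank la) \<and> symbol_admissible s m mu \<and>
      bip_symbol s m mu = exchange_pairs (bip_symbol s m la)"
    using ex assms by (auto simp: exchange_related_def bipartitions_def)
  show "nu = mu" if "nu \<in> bipartitions (bip_rank la) \<and> symbol_admissible s m nu \<and>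
      bip_symbol s m nu = exchange_pairs (bip_symbol s m la)" for nu
    using that ex assms(1) by (intro bip_symbol_inj[of nu mu s m])
      (auto simp: exchange_related_def bipartitions_def)
qed

theorem theorem4p6:
  fixes e :: int and s0 s1 n m :: nat and la :: bipartition
  assumes "e > 1"
    and "s0 \<le> s1"
    and "la \<in> uglov_bipartitions e (int s0, int s1) n"
    and "symbol_admissible (s0, s1) m la"
  shows "crystal_Psi e (int s0, int s1) (int s0, int s1 + e) la = symbol_Upsilon (s0, s1) m la"
proof -
  let ?s = "(s0, s1)"
  have charge: "(int s0, int s1) = charge False e ?s" "(int s0, int s1 + e) = charge True e ?s"
    by (simp_all add: charge_def)
  have le: "fst ?s \<le> snd ?s" using assms(2) by simp
  obtain mu where mu: "Psi_graph e (charge False e ?s) (charge True e ?s) la mu"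
    using Psi_graph_exists[OF assms(1) le _ assms(4)] assms(3) unfolding charge by blast
  have ups: "nu = symbol_Upsilon ?s m la" if "Psi_graph e (charge False e ?s) (charge True e ?s) la nu" for nu
    using symbol_Upsilon_eq[OF Psi_graph_exchange_related[OF assms(1) le that assms(4)] Psi_graph_rank[OF that]] ..
  then show ?thesis unfolding crystal_Psi_def charge using mu by (metis (no_types, lifting) the_equality)
qed

end
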